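(* Let $k$ be a field of characteristic $0$, $n\ge1$, $P=k((x_1))\dots((x_n))((\partial_1^{-1}))\dots((\partial_n^{-1}))$, and $P'=\{L=(L_1,\dots,L_n)\in P^n:[L_i,L_j]=0\text{ for all }i,j\}$. For $m\in\mathbf Z_{\ge0}^n$ let $V^m$ be the vector field on $P^n$ $$V^m_L=\big([(L_1^{m_1}\cdots L_n^{m_n})_+,L_1],\dots,[(L_1^{m_1}\cdots L_n^{m_n})_+,L_n]\big)\in T_L=P^n .$$ Let $L\in P'$. Then: i) $V^m_L\in T_{P',L}$, i.e. $V^m$ is tangent to $P'$ at $L$; ii) for all $m,l\in\mathbf Z_{\ge0}^n$ the vector fields $V^m|_{P'}$ and $V^l|_{P'}$ commute.
   Context: For an associative ring $A$ with a derivation $d$, $A((\partial^{-1}))$ is the left $A$-module of formal expressions $\sum_{i\le N}a_i\partial^i$ ($a_i\in A$, $N\in\mathbf{Z}$) with multiplication $(\sum_i a_i\partial^i)(\sum_j b_j\partial^j)=\sum_{i,j;\,l\ge0}\binom{i}{l}a_id^l(b_j)\partial^{i+j-l}$. The ring $P$ is obtained by iterating this construction $n$ times, starting from the field of iterated Laurent series $k((x_1))\dots((x_n))$; at the $i$-th step $\partial_i^{-1}$ is adjoined using the derivation $\partial/\partial x_i$ acting on coefficients (and killing $\partial_1,\dots,\partial_{i-1}$). For $L=\sum_{i\le N}a_i\partial_n^i\in P$ (the $a_i$ being operators in $\partial_1,\dots,\partial_{n-1}$) put $L_+=\sum_{i\ge0}a_i\partial_n^i$ and $L_-=\sum_{i<0}a_i\partial_n^i$.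 $[A,B]=AB-BA$. $P^n$ is regarded as an infinite-dimensional variety whose tangent space at each point is $P^n$. The tangent space $T_{P',L}$ at $L\in P'$ is the set of $X=(X_1,\dots,X_n)\in P^n$ such that $[L_i+\epsilon X_i,L_j+\epsilon X_j]=0$ modulo $\epsilon^2$ for all $i,j$. Two such vector fields $V,W$ commute on $P'$ if at each $L\in P'$ the directional derivative of $W$ along $V_L$ equals the directional derivative of $V$ along $W_L$, where the derivative of $W$ at $L$ along $X$ is the coefficient of $\epsilon$ in $W_{L+\epsilon X}$ modulo $\epsilon^2$; equivalently $\frac{\partial}{\partial t_m}\frac{\partial}{\partial t_l}L_i=\frac{\partial}{\partial t_l}\frac{\partial}{\partial t_m}L_i$ when computed formally from the equations $\partial L/\partial t_m=V^m_L$, $\partial L/\partial t_l=V^l_L$. *)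

theory Defs
  imports Complex_Main "HOL-Algebra.Weak_Morphisms"
begin

section \<open>Laurent series and pseudo-differential operators over a ring\<close>

definition laurent_ring :: "('a, 'b) ring_scheme \<Rightarrow> (int \<Rightarrow> 'a) ring" where
  "laurent_ring A =
    \<lparr> carrier = {f. (\<forall>i. f i \<in> carrier A) \<and> (\<exists>N. \<forall>i<N. f i = \<zero>\<^bsub>A\<^esub>)},
      mult = (\<lambda>f g k. finsum A (\<lambda>(i, j). f i \<otimes>\<^bsub>A\<^esub> g j)
                 {(i, j). i + j = k \<and> f i \<noteq> \<zero>\<^bsub>A\<^esub> \<and> g j \<noteq> \<zero>\<^bsub>A\<^esub>}),
      one = (\<lambda>i. if i = 0 then \<one>\<^bsub>A\<^esub> else \<zero>\<^bsub>A\<^esub>),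
      zero = (\<lambda>i. \<zero>\<^bsub>A\<^esub>),
      add = (\<lambda>f g i. f i \<oplus>\<^bsub>A\<^esub> g i) \<rparr>"

text \<open>The integer \<open>i (i - 1) \<dots> (i - l + 1) / l!\<close> for \<open>i\<close> of any sign.  This
  is what \<^const>\<open>gbinomial\<close> unfolds to; its sort constraint may exclude \<^typ>\<open>int\<close>.\<close>

definition int_choose :: "int \<Rightarrow> nat \<Rightarrow> int" where
  "int_choose i l = (\<Prod>j = 0..<l. i - int j) div fact l"

lemma of_int_int_choose: "of_int (int_choose i l) = (of_int i :: 'a :: field_char_0) gchoose l"
proof -
  have "fact l dvd (\<Prod>j = 0..<l. i - int j)"
    using fact_dvd_pochhammer[of l "i - int l + 1"] by (simp add: falling_fact_pochhammer')
  then have "fact l * int_choose i l = (\<Prod>j = 0..<l. i - int j)"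
    by (simp add: int_choose_def)
  then have "of_int (fact l * int_choose i l) = (of_int (\<Prod>j = 0..<l. i - int j) :: 'a)"
    by (rule arg_cong)
  then show ?thesis
    by (simp add: gbinomial_prod_rev field_simps)
qed

text \<open>The ring \<open>A((\<partial>\<inverse>))\<close> for a derivation \<open>d\<close> of \<open>A\<close>; \<open>f\<close> stands for the formal
  sum of the \<open>f i \<partial>\<^sup>i\<close>, with coefficients on the left.  On the carrier the index sets of
  the sums are finite, since the exponents of both factors are bounded above.\<close>

definition psdo_ring :: "('a, 'b) ring_scheme \<Rightarrow> ('a \<Rightarrow> 'a) \<Rightarrow> (int \<Rightarrow> 'a) ring" where
  "psdo_ring A d =
    \<lparr> carrier = {f. (\<forall>i. f i \<in> carrier A) \<and> (\<exists>N. \<forall>i>N. f i = \<zero>\<^bsub>A\<^esub>)},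
      mult = (\<lambda>f g k. finsum A (\<lambda>(i, j, l). [int_choose i l] \<cdot>\<^bsub>A\<^esub> (f i \<otimes>\<^bsub>A\<^esub> (d ^^ l) (g j)))
                 {(i, j, l::nat). i + j - int l = k \<and> f i \<noteq> \<zero>\<^bsub>A\<^esub> \<and> g j \<noteq> \<zero>\<^bsub>A\<^esub>}),
      one = (\<lambda>i. if i = 0 then \<one>\<^bsub>A\<^esub> else \<zero>\<^bsub>A\<^esub>),
      zero = (\<lambda>i. \<zero>\<^bsub>A\<^esub>),
      add = (\<lambda>f g i. f i \<oplus>\<^bsub>A\<^esub> g i) \<rparr>"

section \<open>The iterated ring\<close>

text \<open>Each of the two constructions above changes the type of the elements.  To iterate them a
  variable number of times, all stages are relabelled, by means of \<^const>\<open>image_ring\<close>, into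
  the single type of functions from exponent lists to the field.  The element \<open>f\<close> stands for
  the formal sum of the \<open>f [a\<^sub>1, \<dots>, a\<^sub>n, b\<^sub>1, \<dots>, b\<^sub>r]\<close> times
  \<open>x\<^sub>1 ^ a\<^sub>1 \<dots> x\<^sub>n ^ a\<^sub>n \<partial>\<^sub>1 ^ b\<^sub>1 \<dots> \<partial>\<^sub>r ^ b\<^sub>r\<close>; the exponent of the variable
  adjoined last is the last entry.  Positions are counted from 0, so the exponent of
  \<open>x\<^sub>i\<close> sits at position \<open>i - 1\<close>.\<close>

definition const_elem :: "('a, 'b) ring_scheme \<Rightarrow> 'a \<Rightarrow> (int list \<Rightarrow> 'a)" where
  "const_elem K c = (\<lambda>w. if w = [] then c else \<zero>\<^bsub>K\<^esub>)"

definition flatten :: "('a, 'b) ring_scheme \<Rightarrow> (int \<Rightarrow> int list \<Rightarrow> 'a) \<Rightarrow> (int list \<Rightarrow> 'a)" where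
  "flatten K h = (\<lambda>w. if w = [] then \<zero>\<^bsub>K\<^esub> else h (last w) (butlast w))"

lemma inj_const_elem: "inj (const_elem K)"
  unfolding inj_def const_elem_def by (metis (full_types))

lemma inj_flatten: "inj (flatten K)"
proof (rule injI)
  fix h h' assume eq: "flatten K h = flatten K h'"
  have "h i w = h' i w" for i w
    using fun_cong[OF eq, of "w @ [i]"] by (simp add: flatten_def)
  then show "h = h'" by blast
qed

primrec iterated_laurent :: "('a, 'b) ring_scheme \<Rightarrow> nat \<Rightarrow> (int list \<Rightarrow> 'a) ring" where
  "iterated_laurent K 0 = image_ring (const_elem K) K"
| "iterated_laurent K (Suc n) = image_ring (flatten K) (laurent_ring (iterated_laurent K n))"

text \<open>The derivation with respect to the variable at position \<open>p\<close>: it acts on the coefficients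
  and kills all other variables.\<close>

definition partial_deriv :: "('a, 'b) ring_scheme \<Rightarrow> nat \<Rightarrow> (int list \<Rightarrow> 'a) \<Rightarrow> (int list \<Rightarrow> 'a)" where
  "partial_deriv K p f =
    (\<lambda>w. if p < length w then [(w ! p + 1)] \<cdot>\<^bsub>K\<^esub> f (w[p := w ! p + 1]) else \<zero>\<^bsub>K\<^esub>)"

text \<open>\<open>iterated_psdo K n r\<close> is
  \<open>K((x\<^sub>1))\<dots>((x\<^sub>n))((\<partial>\<^sub>1\<inverse>))\<dots>((\<partial>\<^sub>r\<inverse>))\<close>.\<close>

primrec iterated_psdo :: "('a, 'b) ring_scheme \<Rightarrow> nat \<Rightarrow> nat \<Rightarrow> (int list \<Rightarrow> 'a) ring" where
  "iterated_psdo K n 0 = iterated_laurent K n"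
| "iterated_psdo K n (Suc r) =
     image_ring (flatten K) (psdo_ring (iterated_psdo K n r) (partial_deriv K r))"

definition P_ring :: "('a, 'b) ring_scheme \<Rightarrow> nat \<Rightarrow> (int list \<Rightarrow> 'a) ring" where
  "P_ring K n = iterated_psdo K n n"

text \<open>The part \<open>L\<^sub>+\<close> with respect to the variable adjoined last, which is \<open>\<partial>\<^sub>n\<close> for
  elements of \<open>P_ring K n\<close> with \<open>n \<ge> 1\<close>.\<close>

definition plus_part :: "('a, 'b) ring_scheme \<Rightarrow> (int list \<Rightarrow> 'a) \<Rightarrow> (int list \<Rightarrow> 'a)" where
  "plus_part K f = (\<lambda>w. if w \<noteq> [] \<and> 0 \<le> last w then f w else \<zero>\<^bsub>K\<^esub>)"

section \<open>Vector fields\<close>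

definition commutator :: "('a, 'b) ring_scheme \<Rightarrow> 'a \<Rightarrow> 'a \<Rightarrow> 'a" where
  "commutator R a b = a \<otimes>\<^bsub>R\<^esub> b \<ominus>\<^bsub>R\<^esub> b \<otimes>\<^bsub>R\<^esub> a"

text \<open>The ring \<open>R[\<epsilon>]/(\<epsilon>\<^sup>2)\<close>, with \<open>(a, b)\<close> standing for \<open>a + \<epsilon>b\<close>.\<close>

definition dual_ring :: "('a, 'b) ring_scheme \<Rightarrow> ('a \<times> 'a) ring" where
  "dual_ring R =
    \<lparr> carrier = carrier R \<times> carrier R,
      mult = (\<lambda>(a, b) (c, d). (a \<otimes>\<^bsub>R\<^esub> c, a \<otimes>\<^bsub>R\<^esub> d \<oplus>\<^bsub>R\<^esub> b \<otimes>\<^bsub>R\<^esub> c)),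
      one = (\<one>\<^bsub>R\<^esub>, \<zero>\<^bsub>R\<^esub>),
      zero = (\<zero>\<^bsub>R\<^esub>, \<zero>\<^bsub>R\<^esub>),
      add = (\<lambda>(a, b) (c, d). (a \<oplus>\<^bsub>R\<^esub> c, b \<oplus>\<^bsub>R\<^esub> d)) \<rparr>"

definition tuples :: "('a, 'b) ring_scheme \<Rightarrow> nat \<Rightarrow> (nat \<Rightarrow> 'a) set" where
  "tuples R n = {..<n} \<rightarrow>\<^sub>E carrier R"

definition commuting_tuples :: "('a, 'b) ring_scheme \<Rightarrow> nat \<Rightarrow> (nat \<Rightarrow> 'a) set" where
  "commuting_tuples R n = {L \<in> tuples R n. \<forall>i<n. \<forall>j<n. commutator R (L i) (L j) = \<zero>\<^bsub>R\<^esub>}"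

text \<open>The point \<open>L + \<epsilon>X\<close>.\<close>

definition infinitesimal_shift :: "nat \<Rightarrow> (nat \<Rightarrow> 'a) \<Rightarrow> (nat \<Rightarrow> 'a) \<Rightarrow> (nat \<Rightarrow> 'a \<times> 'a)" where
  "infinitesimal_shift n L X = (\<lambda>i\<in>{..<n}. (L i, X i))"

definition tangent_space :: "('a, 'b) ring_scheme \<Rightarrow> nat \<Rightarrow> (nat \<Rightarrow> 'a) \<Rightarrow> (nat \<Rightarrow> 'a) set" where
  "tangent_space R n L =
    {X \<in> tuples R n. \<forall>i<n. \<forall>j<n.
       commutator (dual_ring R) (infinitesimal_shift n L X i) (infinitesimal_shift n L X j)
         = \<zero>\<^bsub>dual_ring R\<^esub>}"

text \<open>The ordered product \<open>L\<^sub>1 ^ m\<^sub>1 \<dots> L\<^sub>n ^ m\<^sub>n\<close>; the ring is not commutative.\<close>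

definition power_product :: "('a, 'b) ring_scheme \<Rightarrow> nat \<Rightarrow> (nat \<Rightarrow> 'a) \<Rightarrow> (nat \<Rightarrow> nat) \<Rightarrow> 'a" where
  "power_product R n L m = foldr (\<lambda>i y. L i [^]\<^bsub>R\<^esub> m i \<otimes>\<^bsub>R\<^esub> y) [0..<n] \<one>\<^bsub>R\<^esub>"

text \<open>The formula for the field \<open>V\<^sup>m\<close>, with the ring \<open>R\<close> and the map \<open>p\<close> playing the role of
  \<open>L \<mapsto> L\<^sub>+\<close> as parameters, so that it can also be evaluated at \<open>L + \<epsilon>X\<close>.\<close>

definition lax_field ::
  "('a, 'b) ring_scheme \<Rightarrow> ('a \<Rightarrow> 'a) \<Rightarrow> nat \<Rightarrow> (nat \<Rightarrow> nat) \<Rightarrow> (nat \<Rightarrow> 'a) \<Rightarrow> (nat \<Rightarrow> 'a)" where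
  "lax_field R p n m L = (\<lambda>i\<in>{..<n}. commutator R (p (power_product R n L m)) (L i))"

definition V_field ::
  "('a, 'b) ring_scheme \<Rightarrow> nat \<Rightarrow> (nat \<Rightarrow> nat) \<Rightarrow> (nat \<Rightarrow> int list \<Rightarrow> 'a) \<Rightarrow> (nat \<Rightarrow> int list \<Rightarrow> 'a)" where
  "V_field K n m = lax_field (P_ring K n) (plus_part K) n m"

text \<open>The derivative at \<open>L\<close> along \<open>X\<close>, that is, the coefficient of \<open>\<epsilon>\<close> in the value of
  \<open>V\<^sup>m\<close> at \<open>L + \<epsilon>X\<close>.  Here \<open>(a + \<epsilon>b)\<^sub>+ = a\<^sub>+ + \<epsilon>b\<^sub>+\<close>.\<close>

definition V_field_deriv ::
  "('a, 'b) ring_scheme \<Rightarrow> nat \<Rightarrow> (nat \<Rightarrow> nat) \<Rightarrow> (nat \<Rightarrow> int list \<Rightarrow> 'a) \<Rightarrow> (nat \<Rightarrow> int list \<Rightarrow> 'a)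
     \<Rightarrow> (nat \<Rightarrow> int list \<Rightarrow> 'a)" where
  "V_field_deriv K n m L X =
    (\<lambda>i\<in>{..<n}. snd (lax_field (dual_ring (P_ring K n)) (map_prod (plus_part K) (plus_part K)) n m
                       (infinitesimal_shift n L X) i))"

definition V_fields_commute_on ::
  "('a, 'b) ring_scheme \<Rightarrow> nat \<Rightarrow> (nat \<Rightarrow> nat) \<Rightarrow> (nat \<Rightarrow> nat) \<Rightarrow> (nat \<Rightarrow> int list \<Rightarrow> 'a) set \<Rightarrow> bool" where
  "V_fields_commute_on K n m l S \<longleftrightarrow>
    (\<forall>L\<in>S. V_field_deriv K n l L (V_field K n m L) = V_field_deriv K n m L (V_field K n l L))"

end

theory Submission
  imports Defs "Jordan_Normal_Form.Missing_Ring" "HOL-Computational_Algebra.Formal_Power_Series"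
begin

text \<open>
  Everything rests on two facts about the operators \<open>[A, -]\<close>: such an operator is a derivation,
  and a derivation \<open>d\<close> of a ring \<open>R\<close> is the same thing as a ring homomorphism
  \<open>a \<mapsto> a + \<epsilon> d(a)\<close> from \<open>R\<close> to the dual numbers \<open>R[\<epsilon>]/(\<epsilon>\<^sup>2)\<close>.  Put \<open>M = L\<^sup>m\<close> and
  \<open>A = M\<^sub>+\<close>.  At \<open>L\<close> the field \<open>V\<^sup>m\<close> is \<open>[A, L]\<close>, so \<open>L + \<epsilon> V\<^sup>m\<close> is the image of \<open>L\<close> under the
  homomorphism belonging to \<open>[A, -]\<close>.  A homomorphism preserves the relations \<open>[L\<^sub>i, L\<^sub>j] = 0\<close>,
  which is tangency.  It also sends \<open>N = L\<^sup>l\<close> to \<open>N + \<epsilon> [A, N]\<close>, so with \<open>B = N\<^sub>+\<close> the derivative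
  of \<open>V\<^sup>l\<close> along \<open>V\<^sup>m\<close> has the components \<open>[B, [A, L\<^sub>i]] + [[A, N]\<^sub>+, L\<^sub>i]\<close>.  By the Jacobi
  identity this is symmetric in \<open>m\<close> and \<open>l\<close> as soon as \<open>[A, N]\<^sub>+ - [B, M]\<^sub>+ = [A, B]\<close>, the equation
  of zero curvature (\<open>zero_curvature\<close>).  It follows from \<open>[M, N] = 0\<close> by splitting \<open>M\<close> and \<open>N\<close>
  into their parts, for the only property of \<open>L \<mapsto> L\<^sub>+\<close> that enters is that \<open>P\<close> is the sum of two
  additive subgroups closed under multiplication.  This abstract argument is carried out in the locale
  \<open>ring_splitting\<close>.

  The remaining and larger part of the work is that \<open>P\<close> is such a ring, above all that it is
  associative.  For one extension \<open>R((\<partial>\<inverse>))\<close> this is reduced to monomials, where it is the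
  higher Leibniz rule together with the Vandermonde identity (\<open>monom_mult_assoc\<close>); only finitely
  many terms of the factors contribute to a given coefficient of a product.  Laurent series need no
  separate proof: \<open>R((x))\<close> is the case of the zero derivation, with \<open>x = \<partial>\<inverse>\<close>.  In the iteration
  one has to carry along that the partial derivatives are commuting derivations of every stage;
  this is the invariant \<open>coefficient_ring\<close>.
\<close>

section \<open>Derivations and integer multiples\<close>

locale derivation = ring A for A (structure) +
  fixes d :: "'a \<Rightarrow> 'a"
  assumes d_closed [simp]: "a \<in> carrier A \<Longrightarrow> d a \<in> carrier A"
    and d_add: "a \<in> carrier A \<Longrightarrow> b \<in> carrier A \<Longrightarrow> d (a \<oplus> b) = d a \<oplus> d b"
    and d_mult: "a \<in> carrier A \<Longrightarrow> b \<in> carrier A \<Longrightarrow> d (a \<otimes> b) = a \<otimes> d b \<oplus> d a \<otimes> b"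
begin

lemma d_group_hom: "group_hom (add_monoid A) (add_monoid A) d"
  by (auto simp: group_hom_def group_hom_axioms_def hom_def d_add add.is_group)

lemma d_zero [simp]: "d \<zero> = \<zero>"
  using group_hom.hom_one[OF d_group_hom] by simp

lemma d_one [simp]: "d \<one> = \<zero>"
proof -
  have "d (\<one> \<otimes> \<one>) = d \<one> \<oplus> d \<one>"
    by (subst d_mult) auto
  then show ?thesis
    using add.l_cancel_one[of "d \<one>" "d \<one>"] by auto
qed

lemma d_add_pow: "a \<in> carrier A \<Longrightarrow> d ([(c::int)] \<cdot> a) = [c] \<cdot> d a"
  using group_hom.hom_int_pow[OF d_group_hom, of a c] by (simp add: add_pow_def)

lemma d_finsum: "f \<in> I \<rightarrow> carrier A \<Longrightarrow> d (finsum A f I) = finsum A (\<lambda>i. d (f i)) I"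
proof (induction I rule: infinite_finite_induct)
  case (insert x F)
  then show ?case
    by (simp add: Pi_def d_add finsum_closed)
qed auto

lemma higher_d_closed [simp]: "a \<in> carrier A \<Longrightarrow> (d ^^ l) a \<in> carrier A"
  by (induction l) auto

lemma higher_d_add:
  "a \<in> carrier A \<Longrightarrow> b \<in> carrier A \<Longrightarrow> (d ^^ l) (a \<oplus> b) = (d ^^ l) a \<oplus> (d ^^ l) b"
  by (induction l) (auto simp: d_add)

lemma higher_d_zero [simp]: "(d ^^ l) \<zero> = \<zero>"
  by (induction l) auto

lemma higher_d_one: "(d ^^ l) \<one> = (if l = 0 then \<one> else \<zero>)"
  by (induction l) auto

lemma higher_d_add_pow: "a \<in> carrier A \<Longrightarrow> (d ^^ l) ([(c::int)] \<cdot> a) = [c] \<cdot> (d ^^ l) a"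
  by (induction l) (auto simp: d_add_pow)

end

context ring
begin

lemma add_pow_distrib_int:
  "a \<in> carrier R \<Longrightarrow> b \<in> carrier R \<Longrightarrow> [(c::int)] \<cdot> (a \<oplus> b) = [c] \<cdot> a \<oplus> [c] \<cdot> b"
  using add.int_pow_distrib[of a b c] by (simp add: add_pow_def)

lemma add_pow_add_int: "a \<in> carrier R \<Longrightarrow> [(b + c::int)] \<cdot> a = [b] \<cdot> a \<oplus> [c] \<cdot> a"
  using add.int_pow_mult[of a b c] by (simp add: add_pow_def)

lemma add_pow_mult_int: "a \<in> carrier R \<Longrightarrow> [b] \<cdot> ([c] \<cdot> a) = [(b * c::int)] \<cdot> a"
  using add.int_pow_pow[of a b c] by (simp add: add_pow_def mult.commute)

lemma add_pow_closed_int [simp]: "a \<in> carrier R \<Longrightarrow> [(c::int)] \<cdot> a \<in> carrier R"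
  using add.int_pow_closed[of a c] by (simp add: add_pow_def)

lemma add_pow_zero_int [simp]: "[(c::int)] \<cdot> \<zero> = \<zero>"
  using add.int_pow_one[of c] by (simp add: add_pow_def)

lemma zero_add_pow_int [simp]: "[(0::int)] \<cdot> a = \<zero>"
  by (simp add: add_pow_def)

lemma one_add_pow_int [simp]: "a \<in> carrier R \<Longrightarrow> [(1::int)] \<cdot> a = a"
  using add.int_pow_1[of a] by (simp add: add_pow_def)

lemma add_pow_finsum_int:
  "f \<in> I \<rightarrow> carrier R \<Longrightarrow> [(c::int)] \<cdot> finsum R f I = (\<Oplus>i\<in>I. [c] \<cdot> f i)"
proof (induction I rule: infinite_finite_induct)
  case (insert x F)
  then show ?case
    by (simp add: Pi_def add_pow_distrib_int finsum_closed)
qed auto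

lemma finsum_add_pow_int:
  "a \<in> carrier R \<Longrightarrow> (\<Oplus>i\<in>I. [(c i :: int)] \<cdot> a) = [(sum c I)] \<cdot> a"
proof (induction I rule: infinite_finite_induct)
  case (insert x F)
  then show ?case
    by (simp add: Pi_def add_pow_add_int)
qed auto

end

text \<open>
  The conjugate of a derivation by an isomorphism is a derivation.  The map \<open>e\<close> is only compared
  with this conjugate on the carrier, because the stages of the iteration are relabelled copies of
  other rings and their derivations are given by explicit formulas.
\<close>

lemma derivation_ring_iso:
  assumes h: "h \<in> ring_iso R S" and "derivation R d" and "ring S"
    and e: "\<And>a. a \<in> carrier R \<Longrightarrow> e (h a) = h (d a)"
  shows "derivation S e"
proof -
  interpret d: derivation R d by fact
  interpret S: ring S by fact
  interpret h: ring_hom_ring R S h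
    by (intro ring_hom_ringI2 d.ring_axioms S.ring_axioms) (use h in \<open>simp add: ring_iso_def\<close>)
  have surj: "carrier S = h ` carrier R"
    using h by (auto simp: ring_iso_def bij_betw_def)
  show ?thesis
  proof unfold_locales
    fix x y assume "x \<in> carrier S" "y \<in> carrier S"
    then obtain a b where ab: "a \<in> carrier R" "b \<in> carrier R" and xy: "x = h a" "y = h b"
      by (auto simp: surj)
    show "e x \<in> carrier S"
      using ab by (simp add: xy e)
    show "e (x \<oplus>\<^bsub>S\<^esub> y) = e x \<oplus>\<^bsub>S\<^esub> e y"
      using ab e[of "a \<oplus>\<^bsub>R\<^esub> b"] by (simp add: xy e d.d_add)
    show "e (x \<otimes>\<^bsub>S\<^esub> y) = x \<otimes>\<^bsub>S\<^esub> e y \<oplus>\<^bsub>S\<^esub> e x \<otimes>\<^bsub>S\<^esub> y"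
      using ab e[of "a \<otimes>\<^bsub>R\<^esub> b"] by (simp add: xy e d.d_mult)
  qed
qed

lemma (in ring) zero_derivation: "derivation R (\<lambda>_. \<zero>)"
  by unfold_locales auto

section \<open>Dual numbers and commutators\<close>

lemma dual_ring_simps [simp]:
  "carrier (dual_ring R) = carrier R \<times> carrier R"
  "(a, b) \<otimes>\<^bsub>dual_ring R\<^esub> (a', b') = (a \<otimes>\<^bsub>R\<^esub> a', a \<otimes>\<^bsub>R\<^esub> b' \<oplus>\<^bsub>R\<^esub> b \<otimes>\<^bsub>R\<^esub> a')"
  "(a, b) \<oplus>\<^bsub>dual_ring R\<^esub> (a', b') = (a \<oplus>\<^bsub>R\<^esub> a', b \<oplus>\<^bsub>R\<^esub> b')"
  "\<one>\<^bsub>dual_ring R\<^esub> = (\<one>\<^bsub>R\<^esub>, \<zero>\<^bsub>R\<^esub>)"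
  "\<zero>\<^bsub>dual_ring R\<^esub> = (\<zero>\<^bsub>R\<^esub>, \<zero>\<^bsub>R\<^esub>)"
  by (simp_all add: dual_ring_def)

context ring
begin

lemma dual_ring_is_ring: "ring (dual_ring R)"
proof (rule ringI)
  show "abelian_group (dual_ring R)"
  proof (rule abelian_groupI)
    fix x assume "x \<in> carrier (dual_ring R)"
    then show "\<exists>y\<in>carrier (dual_ring R). y \<oplus>\<^bsub>dual_ring R\<^esub> x = \<zero>\<^bsub>dual_ring R\<^esub>"
      by (intro bexI[of _ "(\<ominus> fst x, \<ominus> snd x)"]) (auto simp: l_neg)
  qed (auto simp: a_ac)
  show "monoid (dual_ring R)"
    by (rule monoidI) (auto simp: m_assoc l_distr r_distr a_ac)
qed (auto simp: l_distr r_distr a_ac)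

lemma a_inv_dual_ring:
  "a \<in> carrier R \<Longrightarrow> b \<in> carrier R \<Longrightarrow> \<ominus>\<^bsub>dual_ring R\<^esub> (a, b) = (\<ominus> a, \<ominus> b)"
  by (intro abelian_group.minus_equality[OF ring.is_abelian_group[OF dual_ring_is_ring]])
    (auto simp: l_neg)

lemma commutator_dual_ring:
  assumes "a \<in> carrier R" "b \<in> carrier R" "a' \<in> carrier R" "b' \<in> carrier R"
  shows "commutator (dual_ring R) (a, b) (a', b')
    = (commutator R a a', commutator R a b' \<oplus> commutator R b a')"
  using assms by (simp add: commutator_def a_minus_def a_inv_dual_ring minus_add a_ac)

lemma commutator_closed [simp]:
  "a \<in> carrier R \<Longrightarrow> b \<in> carrier R \<Longrightarrow> commutator R a b \<in> carrier R"
  by (simp add: commutator_def)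

lemma commutator_antisym:
  "a \<in> carrier R \<Longrightarrow> b \<in> carrier R \<Longrightarrow> commutator R a b = \<ominus> commutator R b a"
  unfolding commutator_def by algebra

lemma commutator_add_left:
  "a \<in> carrier R \<Longrightarrow> b \<in> carrier R \<Longrightarrow> c \<in> carrier R \<Longrightarrow>
    commutator R (a \<oplus> b) c = commutator R a c \<oplus> commutator R b c"
  unfolding commutator_def by algebra

lemma commutator_derivation:
  assumes a: "a \<in> carrier R"
  shows "derivation R (commutator R a)"
proof unfold_locales
  fix b c assume "b \<in> carrier R" "c \<in> carrier R"
  with a show "commutator R a (b \<oplus> c) = commutator R a b \<oplus> commutator R a c"
    and "commutator R a (b \<otimes> c) = b \<otimes> commutator R a c \<oplus> commutator R a b \<otimes> c"
    unfolding commutator_def by algebra+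
qed (use a in simp)

end

lemma (in ring_hom_ring) hom_commutator:
  "a \<in> carrier R \<Longrightarrow> b \<in> carrier R \<Longrightarrow> commutator S (h a) (h b) = h (commutator R a b)"
  by (simp add: commutator_def a_minus_def)

text \<open>
  The Leibniz rule is precisely the multiplicativity of \<open>a \<mapsto> a + \<epsilon> d(a)\<close>.
\<close>

lemma (in derivation) dual_ring_hom: "(\<lambda>a. (a, d a)) \<in> ring_hom A (dual_ring A)"
  by (rule ring_hom_memI) (auto simp: d_add d_mult)

lemma (in ring) power_product_closed:
  assumes "L \<in> tuples R n"
  shows "power_product R n L m \<in> carrier R"
proof -
  have "set xs \<subseteq> {..<n} \<Longrightarrow> foldr (\<lambda>i y. L i [^] m i \<otimes> y) xs \<one> \<in> carrier R" for xs
    using assms by (induction xs) (auto simp: tuples_def)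
  then show ?thesis
    by (simp add: power_product_def subset_iff)
qed

text \<open>
  The tuple \<open>L'\<close> may differ from \<open>h \<circ> L\<close> outside \<open>{..<n}\<close>, as the restricted function
  \<open>infinitesimal_shift n L X\<close> does.
\<close>

lemma (in ring) ring_hom_power_product:
  assumes h: "h \<in> ring_hom R S" and "ring S" and L: "L \<in> tuples R n"
    and L': "\<And>i. i < n \<Longrightarrow> L' i = h (L i)"
  shows "power_product S n L' m = h (power_product R n L m)"
proof -
  interpret h: ring_hom_ring R S h
    by (rule ring_hom_ringI2) (use assms ring_axioms in auto)
  have Lc: "i < n \<Longrightarrow> L i \<in> carrier R" for i
    using L by (auto simp: tuples_def)
  have hom_pow: "h (a [^] k) = h a [^]\<^bsub>S\<^esub> k" if "a \<in> carrier R" for a and k :: nat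
    using that by (induction k) auto
  have "set xs \<subseteq> {..<n} \<Longrightarrow> foldr (\<lambda>i y. L i [^] m i \<otimes> y) xs \<one> \<in> carrier R \<and>
      foldr (\<lambda>i y. L' i [^]\<^bsub>S\<^esub> m i \<otimes>\<^bsub>S\<^esub> y) xs \<one>\<^bsub>S\<^esub> = h (foldr (\<lambda>i y. L i [^] m i \<otimes> y) xs \<one>)" for xs
    using Lc L' by (induction xs) (auto simp: hom_pow)
  then show ?thesis
    by (simp add: power_product_def subset_iff)
qed

text \<open>
  The elements killed by a derivation form a subring.  Applied to \<open>[a, -]\<close> this says that whatever
  commutes with all \<open>L\<^sub>i\<close> commutes with their products.
\<close>

lemma (in derivation) d_power_product_eq_zero:
  assumes L: "L \<in> tuples A n" and zero: "\<And>i. i < n \<Longrightarrow> d (L i) = \<zero>"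
  shows "d (power_product A n L m) = \<zero>"
proof -
  have Lc: "i < n \<Longrightarrow> L i \<in> carrier A" for i
    using L by (auto simp: tuples_def)
  have pow: "d (L i [^] k) = \<zero>" if "i < n" for i and k :: nat
    using that by (induction k) (auto simp: d_mult zero Lc)
  have "set xs \<subseteq> {..<n} \<Longrightarrow> foldr (\<lambda>i y. L i [^] m i \<otimes> y) xs \<one> \<in> carrier A \<and>
      d (foldr (\<lambda>i y. L i [^] m i \<otimes> y) xs \<one>) = \<zero>" for xs
    using Lc by (induction xs) (auto simp: d_mult pow)
  then show ?thesis
    by (simp add: power_product_def subset_iff)
qed

lemma (in ring) commutator_power_product_right:
  assumes "L \<in> commuting_tuples R n" "j < n"
  shows "commutator R (L j) (power_product R n L m) = \<zero>"
  using assms derivation.d_power_product_eq_zero[OF commutator_derivation[of "L j"], of L n m]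
  by (auto simp: commuting_tuples_def tuples_def)

lemma (in ring) power_products_commute:
  assumes L: "L \<in> commuting_tuples R n"
  shows "commutator R (power_product R n L m) (power_product R n L l) = \<zero>"
proof (rule derivation.d_power_product_eq_zero)
  have Lt: "L \<in> tuples R n"
    using L by (auto simp: commuting_tuples_def)
  then show "derivation R (commutator R (power_product R n L m))" "L \<in> tuples R n"
    by (auto intro: commutator_derivation power_product_closed)
  fix j assume j: "j < n"
  show "commutator R (power_product R n L m) (L j) = \<zero>"
    using commutator_antisym[OF power_product_closed[OF Lt], of "L j" m] Lt j
      commutator_power_product_right[OF L j] by (auto simp: tuples_def)
qed

section \<open>Lax equations in a ring with a splitting\<close>

text \<open>
  The elements \<open>p a\<close> and \<open>a \<ominus> p a\<close> play the parts of \<open>L\<^sub>+\<close> and \<open>L\<^sub>-\<close>.  The last two assumptions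
  say that a product of two positive parts is again purely positive, and a product of two negative
  parts purely negative.
\<close>

locale ring_splitting = ring R for R (structure) +
  fixes p :: "'a \<Rightarrow> 'a"
  assumes p_closed [simp]: "a \<in> carrier R \<Longrightarrow> p a \<in> carrier R"
    and p_add: "a \<in> carrier R \<Longrightarrow> b \<in> carrier R \<Longrightarrow> p (a \<oplus> b) = p a \<oplus> p b"
    and plus_mult: "a \<in> carrier R \<Longrightarrow> b \<in> carrier R \<Longrightarrow> p (p a \<otimes> p b) = p a \<otimes> p b"
    and minus_mult: "a \<in> carrier R \<Longrightarrow> b \<in> carrier R \<Longrightarrow> p ((a \<ominus> p a) \<otimes> (b \<ominus> p b)) = \<zero>"
begin

lemma p_group_hom: "group_hom (add_monoid R) (add_monoid R) p"
  by (auto simp: group_hom_def group_hom_axioms_def hom_def p_add add.is_group)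

lemma p_minus: "a \<in> carrier R \<Longrightarrow> p (\<ominus> a) = \<ominus> p a"
  using group_hom.hom_inv[OF p_group_hom, of a] by (simp add: a_inv_def)

lemma p_commutator:
  "a \<in> carrier R \<Longrightarrow> b \<in> carrier R \<Longrightarrow> p (commutator R (p a) (p b)) = commutator R (p a) (p b)"
  "a \<in> carrier R \<Longrightarrow> b \<in> carrier R \<Longrightarrow> p (commutator R (a \<ominus> p a) (b \<ominus> p b)) = \<zero>"
  by (simp_all add: commutator_def minus_eq[of "_ \<otimes> _"] p_add p_minus plus_mult minus_mult)

text \<open>
  Write \<open>a = a\<^sub>+ + u\<close> and \<open>b = b\<^sub>+ + v\<close> and apply \<open>p\<close> to \<open>[a, b] = 0\<close>.  Since \<open>[u, v]\<close> has no
  positive part and \<open>[a\<^sub>+, b\<^sub>+]\<close> no negative one, this gives \<open>[b\<^sub>+, u]\<^sub>+ = [a\<^sub>+, b\<^sub>+] + [a\<^sub>+, v]\<^sub>+\<close>.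
  The right-hand side is \<open>[a\<^sub>+, b]\<^sub>+\<close>, and the left-hand side is \<open>[b\<^sub>+, a]\<^sub>+ + [a\<^sub>+, b\<^sub>+]\<close>.
\<close>

lemma zero_curvature:
  assumes a: "a \<in> carrier R" and b: "b \<in> carrier R" and ab: "commutator R a b = \<zero>"
  shows "p (commutator R (p a) b) = p (commutator R (p b) a) \<oplus> commutator R (p a) (p b)"
proof -
  define u v where "u = a \<ominus> p a" and "v = b \<ominus> p b"
  have uv: "u \<in> carrier R" "v \<in> carrier R" and a_eq: "a = p a \<oplus> u" and b_eq: "b = p b \<oplus> v"
    using a b a_lcomm[of "p a" a] a_lcomm[of "p b" b]
    by (simp_all add: u_def v_def minus_eq r_neg)
  interpret pa: derivation R "commutator R (p a)" by (rule commutator_derivation) (use a in simp)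
  interpret pb: derivation R "commutator R (p b)" by (rule commutator_derivation) (use b in simp)
  interpret u: derivation R "commutator R u" by (rule commutator_derivation) (use uv in simp)
  define x y z where "x = commutator R (p a) (p b)"
    and "y = p (commutator R (p a) v)" and "z = p (commutator R (p b) u)"
  have carr: "x \<in> carrier R" "y \<in> carrier R" "z \<in> carrier R"
    using a b uv by (simp_all add: x_def y_def z_def)
  have "\<zero> = p (commutator R (p a \<oplus> u) (p b \<oplus> v))"
    unfolding a_eq[symmetric] b_eq[symmetric] ab using group_hom.hom_one[OF p_group_hom] by simp
  also have "\<dots> = x \<oplus> y \<oplus> (\<ominus> z \<oplus> \<zero>)"
    using a b uv p_commutator[OF a b, folded u_def v_def] commutator_antisym[of u "p b"]
    by (simp add: commutator_add_left pa.d_add u.d_add p_add p_minus x_def y_def z_def)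
  finally have "z = x \<oplus> y \<oplus> \<ominus> z \<oplus> z"
    using carr by simp
  then have z: "z = x \<oplus> y"
    using carr by (simp add: a_assoc l_neg)
  have "p (commutator R (p a) b) = x \<oplus> y"
    using a b uv p_commutator(1)[OF a b] by (subst b_eq) (simp add: pa.d_add p_add x_def y_def)
  moreover have "p (commutator R (p b) a) = \<ominus> x \<oplus> z"
    using a b uv p_commutator(1)[OF a b] commutator_antisym[of "p b" "p a"]
    by (subst a_eq) (simp add: pb.d_add p_add p_minus x_def z_def)
  ultimately show ?thesis
    using carr r_neg1[of x y] by (simp add: z a_ac flip: x_def)
qed

text \<open>
  The shifted tuple \<open>L + \<epsilon> [a, L]\<close> is the image of \<open>L\<close> under a ring homomorphism, so it commutes
  because \<open>L\<close> does.
\<close>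

lemma lax_field_tangent:
  assumes L: "L \<in> commuting_tuples R n"
  shows "lax_field R p n m L \<in> tangent_space R n L"
proof -
  define a where "a = p (power_product R n L m)"
  have Lt: "L \<in> tuples R n"
    using L by (auto simp: commuting_tuples_def)
  then have Lc: "i < n \<Longrightarrow> L i \<in> carrier R" for i
    by (auto simp: tuples_def)
  have a: "a \<in> carrier R"
    using Lt by (simp add: a_def power_product_closed)
  interpret a: derivation R "commutator R a"
    by (rule commutator_derivation) fact
  interpret h: ring_hom_ring R "dual_ring R" "\<lambda>x. (x, commutator R a x)"
    by (intro ring_hom_ringI2 dual_ring_is_ring a.dual_ring_hom ring_axioms)
  have "commutator (dual_ring R) (L i, commutator R a (L i)) (L j, commutator R a (L j)) = \<zero>\<^bsub>dual_ring R\<^esub>"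
    if "i < n" "j < n" for i j
  proof -
    have "commutator (dual_ring R) (L i, commutator R a (L i)) (L j, commutator R a (L j))
        = (commutator R (L i) (L j), commutator R a (commutator R (L i) (L j)))"
      using that Lc h.hom_commutator by simp
    then show ?thesis
      using L that by (simp add: commuting_tuples_def)
  qed
  then show ?thesis
    using Lc a by (auto simp: tangent_space_def lax_field_def infinitesimal_shift_def tuples_def
        simp flip: a_def)
qed

text \<open>
  The same homomorphism evaluates the product \<open>b\<close> of powers at the shifted tuple: it becomes
  \<open>b + \<epsilon> [a, b]\<close>.  The two summands come from the two factors of the commutator.
\<close>

lemma lax_field_deriv:
  fixes m l :: "nat \<Rightarrow> nat"
  assumes L: "L \<in> tuples R n" and i: "i < n"
  defines "a \<equiv> p (power_product R n L m)" and "b \<equiv> power_product R n L l"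
  shows "snd (lax_field (dual_ring R) (map_prod p p) n l
             (infinitesimal_shift n L (lax_field R p n m L)) i)
    = commutator R (p b) (commutator R a (L i)) \<oplus> commutator R (p (commutator R a b)) (L i)"
proof -
  have a: "a \<in> carrier R" and b: "b \<in> carrier R"
    using L by (simp_all add: a_def b_def power_product_closed)
  interpret a: derivation R "commutator R a"
    by (rule commutator_derivation) fact
  have "power_product (dual_ring R) n (infinitesimal_shift n L (lax_field R p n m L)) l
      = (b, commutator R a b)"
    unfolding b_def
    by (rule ring_hom_power_product[OF a.dual_ring_hom dual_ring_is_ring L])
      (simp add: infinitesimal_shift_def lax_field_def a_def)
  moreover have "L i \<in> carrier R"
    using L i by (auto simp: tuples_def)
  ultimately show ?thesis
    using i a b by (simp add: lax_field_def infinitesimal_shift_def commutator_dual_ring flip: a_def)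
qed

lemma lax_fields_commute:
  assumes L: "L \<in> commuting_tuples R n" and i: "i < n"
  shows "snd (lax_field (dual_ring R) (map_prod p p) n l
             (infinitesimal_shift n L (lax_field R p n m L)) i)
       = snd (lax_field (dual_ring R) (map_prod p p) n m
             (infinitesimal_shift n L (lax_field R p n l L)) i)"
proof -
  define a b where "a = power_product R n L m" and "b = power_product R n L l"
  have Lt: "L \<in> tuples R n"
    using L by (auto simp: commuting_tuples_def)
  have carr: "a \<in> carrier R" "b \<in> carrier R" "L i \<in> carrier R"
    using Lt i by (auto simp: a_def b_def power_product_closed tuples_def)
  define e where "e = p (commutator R (p b) a)"
  have e: "e \<in> carrier R"
    using carr by (simp add: e_def)
  have ab: "commutator R a b = \<zero>"
    unfolding a_def b_def by (rule power_products_commute[OF L])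
  have jacobi: "commutator R (commutator R x y) z
      = commutator R x (commutator R y z) \<ominus> commutator R y (commutator R x z)"
    if "x \<in> carrier R" "y \<in> carrier R" "z \<in> carrier R" for x y z
    using that unfolding commutator_def by algebra
  have "commutator R (p (commutator R (p a) b)) (L i)
      = commutator R e (L i) \<oplus> commutator R (commutator R (p a) (p b)) (L i)"
    unfolding zero_curvature[OF carr(1,2) ab] e_def[symmetric]
    using carr e by (simp add: commutator_add_left)
  then have "commutator R (p b) (commutator R (p a) (L i)) \<oplus> commutator R (p (commutator R (p a) b)) (L i)
      = commutator R (p a) (commutator R (p b) (L i)) \<oplus> commutator R e (L i)"
    using carr e by (simp add: jacobi minus_eq a_ac r_neg2 r_neg)
  then show ?thesis
    by (simp add: lax_field_deriv[OF Lt i] a_def b_def e_def)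
qed

end

lemma ring_splitting_ring_iso:
  assumes h: "h \<in> ring_iso R S" and "ring_splitting R p" and "ring S"
    and q: "\<And>a. a \<in> carrier R \<Longrightarrow> q (h a) = h (p a)"
  shows "ring_splitting S q"
proof -
  interpret p: ring_splitting R p by fact
  interpret S: ring S by fact
  interpret h: ring_hom_ring R S h
    by (intro ring_hom_ringI2 p.ring_axioms S.ring_axioms) (use h in \<open>simp add: ring_iso_def\<close>)
  have surj: "carrier S = h ` carrier R"
    using h by (auto simp: ring_iso_def bij_betw_def)
  show ?thesis
  proof unfold_locales
    fix x y assume "x \<in> carrier S" "y \<in> carrier S"
    then obtain a b where ab: "a \<in> carrier R" "b \<in> carrier R" and xy: "x = h a" "y = h b"
      by (auto simp: surj)
    show "q x \<in> carrier S"
      using ab by (simp add: xy q)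
    show "q (x \<oplus>\<^bsub>S\<^esub> y) = q x \<oplus>\<^bsub>S\<^esub> q y"
      using ab q[of "a \<oplus>\<^bsub>R\<^esub> b"] by (simp add: xy q p.p_add)
    show "q (q x \<otimes>\<^bsub>S\<^esub> q y) = q x \<otimes>\<^bsub>S\<^esub> q y"
      using ab q[of "p a \<otimes>\<^bsub>R\<^esub> p b"] by (simp add: xy q p.plus_mult)
    have minus: "h c \<ominus>\<^bsub>S\<^esub> h (p c) = h (c \<ominus>\<^bsub>R\<^esub> p c)" if "c \<in> carrier R" for c
      using that by (simp add: a_minus_def)
    show "q ((x \<ominus>\<^bsub>S\<^esub> q x) \<otimes>\<^bsub>S\<^esub> (y \<ominus>\<^bsub>S\<^esub> q y)) = \<zero>\<^bsub>S\<^esub>"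
      using ab q[of "(a \<ominus>\<^bsub>R\<^esub> p a) \<otimes>\<^bsub>R\<^esub> (b \<ominus>\<^bsub>R\<^esub> p b)"]
      by (simp add: xy q minus p.minus_mult)
  qed
qed

section \<open>Binomial identities\<close>

text \<open>
  The coefficients in the two ways of multiplying out three monomials, compared in
  \<open>monom_mult_assoc\<close>.  By trinomial revision
  \<open>(i choose s) (s choose u) = (i choose u) (i - u choose s - u)\<close> the factor \<open>(i choose u)\<close> comes out
  of the sum, and the Vandermonde convolution remains.
\<close>

lemma int_choose_Vandermonde:
  "(\<Sum>s\<le>M. int_choose i s * int (s choose u) * int_choose j (M - s))
     = int_choose i u * int_choose (i + j - int u) (M - u)" if "u \<le> M"
proof -
  \<comment> \<open>Generalised binomial coefficients live in a field, hence the passage to the rationals.\<close>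
  have "(\<Sum>s\<le>M. ((of_int i :: rat) gchoose s) * (of_nat s gchoose u) * (of_int j gchoose (M - s)))
      = (\<Sum>s\<in>{u..M}. (of_int i gchoose s) * (of_nat s gchoose u) * (of_int j gchoose (M - s)))"
    by (intro sum.mono_neutral_right) (auto simp flip: binomial_gbinomial)
  also have "\<dots> = (\<Sum>s\<in>{u..M}. (of_int i gchoose u) * (of_int i - of_nat u gchoose (s - u)) * (of_int j gchoose (M - s)))"
    by (intro sum.cong) (auto simp: gbinomial_trinomial_revision)
  also have "\<dots> = (\<Sum>s\<in>{0..M-u}. (of_int i gchoose u) * ((of_int i - of_nat u gchoose s) * (of_int j gchoose (M - u - s))))"
    using that by (intro sum.reindex_bij_witness[of _ "\<lambda>s. s + u" "\<lambda>s. s - u"]) auto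
  also have "\<dots> = (of_int i gchoose u) * (of_int i - of_nat u + of_int j gchoose (M - u))"
    by (simp only: gbinomial_Vandermonde flip: sum_distrib_left atLeast0AtMost)
  finally have "(of_int (\<Sum>s\<le>M. int_choose i s * int (s choose u) * int_choose j (M - s)) :: rat)
     = of_int (int_choose i u * int_choose (i + j - int u) (M - u))"
    by (simp add: of_int_int_choose binomial_gbinomial algebra_simps)
  then show ?thesis
    unfolding of_int_eq_iff .
qed

lemma int_choose_0_right [simp]: "int_choose i 0 = 1"
  by (simp add: int_choose_def)

lemma int_choose_eq_0:
  assumes "0 \<le> i" "i < int l"
  shows "int_choose i l = 0"
proof -
  have "(\<Prod>j = 0..<l. i - int j) = 0"
    using assms by (intro prod_zero bexI[of _ "nat i"]) auto
  then show ?thesis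
    by (simp only: int_choose_def div_0)
qed

section \<open>Associativity of the product of pseudo-differential operators\<close>

context derivation
begin

lemma higher_leibniz:
  assumes a [simp]: "a \<in> carrier A" and b [simp]: "b \<in> carrier A"
  shows "(d ^^ s) (a \<otimes> b) = (\<Oplus>u\<in>{..s}. [(int (s choose u))] \<cdot> ((d ^^ u) a \<otimes> (d ^^ (s - u)) b))"
proof (induction s)
  case 0
  show ?case by simp
next
  case (Suc s)
  let ?X = "\<lambda>u. (d ^^ u) a \<otimes> (d ^^ (Suc s - u)) b"
  have "(d ^^ Suc s) (a \<otimes> b) = d (\<Oplus>u\<in>{..s}. [(int (s choose u))] \<cdot> ((d ^^ u) a \<otimes> (d ^^ (s - u)) b))"
    using Suc by simp
  also have "\<dots> = (\<Oplus>u\<in>{..s}. [(int (s choose u))] \<cdot> ?X u \<oplus> [(int (s choose u))] \<cdot> ?X (Suc u))"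
    by (subst d_finsum)
      (auto intro!: finsum_cong' simp: d_add_pow d_mult add_pow_distrib_int Suc_diff_le)
  also have "\<dots> = (\<Oplus>u\<in>{..s}. [(int (s choose u))] \<cdot> ?X u) \<oplus> (\<Oplus>u\<in>{..s}. [(int (s choose u))] \<cdot> ?X (Suc u))"
    by (intro finsum_addf) auto
  also have "(\<Oplus>u\<in>{..s}. [(int (s choose u))] \<cdot> ?X u) = (\<Oplus>u\<in>{..Suc s}. [(int (s choose u))] \<cdot> ?X u)"
    by (subst finsum_Suc) (auto simp: binomial_eq_0)
  also have "\<dots> = (\<Oplus>u\<in>{..s}. [(int (s choose Suc u))] \<cdot> ?X (Suc u)) \<oplus> ?X 0"
    by (subst finsum_Suc2) (auto)
  also have "\<dots> \<oplus> (\<Oplus>u\<in>{..s}. [(int (s choose u))] \<cdot> ?X (Suc u))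
      = (\<Oplus>u\<in>{..s}. [(int (s choose Suc u))] \<cdot> ?X (Suc u) \<oplus> [(int (s choose u))] \<cdot> ?X (Suc u)) \<oplus> ?X 0"
    by (subst finsum_addf) (auto simp: a_ac finsum_closed Pi_def)
  also have "(\<Oplus>u\<in>{..s}. [(int (s choose Suc u))] \<cdot> ?X (Suc u) \<oplus> [(int (s choose u))] \<cdot> ?X (Suc u))
      = (\<Oplus>u\<in>{..s}. [(int (Suc s choose Suc u))] \<cdot> ?X (Suc u))"
    by (intro finsum_cong') (auto simp: add_pow_add_int add.m_comm)
  also have "\<dots> \<oplus> ?X 0 = (\<Oplus>u\<in>{..Suc s}. [(int (Suc s choose u))] \<cdot> ?X u)"
    by (subst finsum_Suc2[of "\<lambda>u. [(int (Suc s choose u))] \<cdot> ?X u"]) auto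
  finally show ?case .
qed

end

lemma psdo_ring_simps [simp]:
  "carrier (psdo_ring A d) = {f. (\<forall>i. f i \<in> carrier A) \<and> (\<exists>N. \<forall>i>N. f i = \<zero>\<^bsub>A\<^esub>)}"
  "\<one>\<^bsub>psdo_ring A d\<^esub> = (\<lambda>i. if i = 0 then \<one>\<^bsub>A\<^esub> else \<zero>\<^bsub>A\<^esub>)"
  "\<zero>\<^bsub>psdo_ring A d\<^esub> = (\<lambda>i. \<zero>\<^bsub>A\<^esub>)"
  "f \<oplus>\<^bsub>psdo_ring A d\<^esub> g = (\<lambda>i. f i \<oplus>\<^bsub>A\<^esub> g i)"
  by (simp_all add: psdo_ring_def)

context derivation
begin

text \<open>
  The coefficient at \<open>\<partial>\<^sup>k\<close> of \<open>(a \<partial>\<^sup>i) (b \<partial>\<^sup>j)\<close>; the power of the derivation is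
  \<open>l = i + j - k\<close>.
\<close>

definition monom_mult_coeff :: "'a \<Rightarrow> int \<Rightarrow> 'a \<Rightarrow> int \<Rightarrow> int \<Rightarrow> 'a" where
  "monom_mult_coeff a i b j k =
     (if k \<le> i + j then [int_choose i (nat (i + j - k))] \<cdot> (a \<otimes> (d ^^ nat (i + j - k)) b) else \<zero>)"

lemma monom_mult_coeff_closed [simp]:
  "a \<in> carrier A \<Longrightarrow> b \<in> carrier A \<Longrightarrow> monom_mult_coeff a i b j k \<in> carrier A"
  by (simp add: monom_mult_coeff_def)

lemma monom_mult_coeff_zero [simp]:
  "a \<in> carrier A \<Longrightarrow> monom_mult_coeff a i \<zero> j k = \<zero>"
  "a \<in> carrier A \<Longrightarrow> monom_mult_coeff \<zero> i a j k = \<zero>"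
  "i + j < k \<Longrightarrow> monom_mult_coeff a i b j k = \<zero>"
  by (simp_all add: monom_mult_coeff_def)

lemma monom_mult_coeff_add_left:
  assumes "a \<in> carrier A" "a' \<in> carrier A" "b \<in> carrier A"
  shows "monom_mult_coeff (a \<oplus> a') i b j k = monom_mult_coeff a i b j k \<oplus> monom_mult_coeff a' i b j k"
  using assms by (simp add: monom_mult_coeff_def l_distr add_pow_distrib_int)

lemma monom_mult_coeff_add_right:
  assumes "a \<in> carrier A" "b \<in> carrier A" "b' \<in> carrier A"
  shows "monom_mult_coeff a i (b \<oplus> b') j k = monom_mult_coeff a i b j k \<oplus> monom_mult_coeff a i b' j k"
  using assms by (simp add: monom_mult_coeff_def higher_d_add r_distr add_pow_distrib_int)

lemma monom_mult_coeff_finsum_left: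
  assumes "f \<in> S \<rightarrow> carrier A" "b \<in> carrier A"
  shows "monom_mult_coeff (finsum A f S) i b j k = (\<Oplus>s\<in>S. monom_mult_coeff (f s) i b j k)"
  using assms by (induction S rule: infinite_finite_induct)
    (auto simp: Pi_def monom_mult_coeff_add_left finsum_closed)

lemma monom_mult_coeff_finsum_right:
  assumes "f \<in> S \<rightarrow> carrier A" "a \<in> carrier A"
  shows "monom_mult_coeff a i (finsum A f S) j k = (\<Oplus>s\<in>S. monom_mult_coeff a i (f s) j k)"
  using assms by (induction S rule: infinite_finite_induct)
    (auto simp: Pi_def monom_mult_coeff_add_right finsum_closed)

lemma finsum_nested_mono_neutral:
  assumes "finite I" "finite J" and S: "S \<subseteq> I \<times> J" and F: "\<And>i j. F i j \<in> carrier A"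
    and zero: "\<And>i j. i \<in> I \<Longrightarrow> j \<in> J \<Longrightarrow> (i, j) \<notin> S \<Longrightarrow> F i j = \<zero>"
  shows "finsum A (\<lambda>(i, j). F i j) S = (\<Oplus>i\<in>I. \<Oplus>j\<in>J. F i j)"
proof -
  have "finsum A (\<lambda>(i, j). F i j) S = finsum A (\<lambda>(i, j). F i j) (I \<times> J)"
    using assms by (intro add.finprod_mono_neutral_cong_left) auto
  also have "\<dots> = (\<Oplus>i\<in>I. \<Oplus>j\<in>J. F i j)"
    using assms by (intro add.finprod_finprod[symmetric]) auto
  finally show ?thesis .
qed

text \<open>
  The product is a sum over triples \<open>(i, j, l)\<close> tied by \<open>i + j - l = k\<close>, over an index set
  that depends on the supports.  Solving for \<open>l\<close> turns it into a double sum, which may be extended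
  to any finite rectangle containing the relevant pairs, so that several products can be compared
  over one common rectangle.
\<close>

lemma psdo_mult:
  assumes f: "f \<in> carrier (psdo_ring A d)" and g: "g \<in> carrier (psdo_ring A d)"
    and fin: "finite I" "finite J"
    and supp: "\<And>i j. f i \<noteq> \<zero> \<Longrightarrow> g j \<noteq> \<zero> \<Longrightarrow> k \<le> i + j \<Longrightarrow> i \<in> I \<and> j \<in> J"
  shows "(f \<otimes>\<^bsub>psdo_ring A d\<^esub> g) k = (\<Oplus>i\<in>I. \<Oplus>j\<in>J. monom_mult_coeff (f i) i (g j) j k)"
proof -
  define S where "S = {(i, j, l::nat). i + j - int l = k \<and> f i \<noteq> \<zero> \<and> g j \<noteq> \<zero>}"
  let ?T = "\<lambda>(i, j). monom_mult_coeff (f i) i (g j) j k"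
  let ?h = "\<lambda>(i, j, l::nat). (i, j)"
  have inj: "inj_on ?h S"
    by (auto simp: inj_on_def S_def)
  have "(f \<otimes>\<^bsub>psdo_ring A d\<^esub> g) k
      = finsum A (\<lambda>(i, j, l). [int_choose i l] \<cdot> (f i \<otimes> (d ^^ l) (g j))) S"
    by (simp add: psdo_ring_def S_def)
  also have "\<dots> = (\<Oplus>x\<in>S. ?T (?h x))"
    using f g by (intro finsum_cong') (auto simp: S_def monom_mult_coeff_def)
  also have "\<dots> = finsum A ?T (?h ` S)"
    using f g by (intro finsum_reindex[OF _ inj, symmetric]) auto
  also have "\<dots> = (\<Oplus>i\<in>I. \<Oplus>j\<in>J. monom_mult_coeff (f i) i (g j) j k)"
  proof (rule finsum_nested_mono_neutral[OF fin])
    show "?h ` S \<subseteq> I \<times> J"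
      using supp by (auto simp: S_def)
  next
    fix i j assume "(i, j) \<notin> ?h ` S"
    then have "(i, j, nat (i + j - k)) \<notin> S"
      by force
    then show "monom_mult_coeff (f i) i (g j) j k = \<zero>"
      using f g by (auto simp: S_def monom_mult_coeff_def)
  qed (use f g in auto)
  finally show ?thesis .
qed

text \<open>
  The rectangle serves all coefficients from \<open>b\<close> upwards at once.  This uniformity is needed for
  products of three factors, where the coefficients of the inner product are themselves summed over.
\<close>

lemma psdo_mult_bounded:
  assumes f: "f \<in> carrier (psdo_ring A d)" and g: "g \<in> carrier (psdo_ring A d)"
    and N: "\<forall>i>N. f i = \<zero>" and M: "\<forall>j>M. g j = \<zero>"
    and le: "b \<le> k"
  shows "(f \<otimes>\<^bsub>psdo_ring A d\<^esub> g) k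
    = (\<Oplus>i\<in>{b - M..N}. \<Oplus>j\<in>{b - N..M}. monom_mult_coeff (f i) i (g j) j k)"
proof (rule psdo_mult[OF f g])
  fix i j assume nz: "f i \<noteq> \<zero>" "g j \<noteq> \<zero>" and "k \<le> i + j"
  moreover have "i \<le> N" "j \<le> M"
    using nz N M by (auto simp: not_less[symmetric])
  ultimately show "i \<in> {b - M..N} \<and> j \<in> {b - N..M}"
    using le by auto
qed auto

lemma psdo_mult_closed:
  assumes f: "f \<in> carrier (psdo_ring A d)" and g: "g \<in> carrier (psdo_ring A d)"
    and N: "\<forall>i>N. f i = \<zero>" and M: "\<forall>j>M. g j = \<zero>"
  shows "(f \<otimes>\<^bsub>psdo_ring A d\<^esub> g) k \<in> carrier A"
    and "k > N + M \<Longrightarrow> (f \<otimes>\<^bsub>psdo_ring A d\<^esub> g) k = \<zero>"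
  using f g by (auto simp: psdo_mult_bounded[OF assms order_refl]
      intro!: finsum_closed add.finprod_one_eqI)

text \<open>
  Both sides are combinations of \<open>X u = a d\<^sup>u(b) d\<^sup>M\<^sup>-\<^sup>u(c)\<close> for \<open>u \<le> M = i + j + q - k\<close>.  On the left
  \<open>p = i + j - u\<close> yields a single multiple of \<open>X u\<close>.  On the right \<open>p = k - i + s\<close> yields
  \<open>a d\<^sup>s(b d\<^sup>M\<^sup>-\<^sup>s(c))\<close>, which the higher Leibniz rule expands; exchanging the sums over \<open>s\<close> and \<open>u\<close>
  collects the coefficients, and these agree by \<open>int_choose_Vandermonde\<close>.
\<close>

lemma monom_mult_assoc:
  assumes abc [simp]: "a \<in> carrier A" "b \<in> carrier A" "c \<in> carrier A"
    and fin: "finite P" "finite P'"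
    and P: "{k - q..i + j} \<subseteq> P" and P': "{k - i..j + q} \<subseteq> P'"
  shows "(\<Oplus>p\<in>P. monom_mult_coeff (monom_mult_coeff a i b j p) p c q k)
       = (\<Oplus>p\<in>P'. monom_mult_coeff a i (monom_mult_coeff b j c q p) p k)"
proof (cases "k \<le> i + j + q")
  case False
  have "(\<Oplus>p\<in>P. monom_mult_coeff (monom_mult_coeff a i b j p) p c q k) = \<zero>"
    using False by (intro add.finprod_one_eqI) (simp add: monom_mult_coeff_def)
  moreover have "(\<Oplus>p\<in>P'. monom_mult_coeff a i (monom_mult_coeff b j c q p) p k) = \<zero>"
    using False by (intro add.finprod_one_eqI) (simp add: monom_mult_coeff_def)
  ultimately show ?thesis by simp
next
  case True
  define M where "M = nat (i + j + q - k)"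
  have M: "int M = i + j + q - k"
    using True by (simp add: M_def)
  define X where "X = (\<lambda>u. a \<otimes> (d ^^ u) b \<otimes> (d ^^ (M - u)) c)"
  have X [simp]: "X u \<in> carrier A" for u
    by (simp add: X_def)
  have "(\<Oplus>p\<in>P. monom_mult_coeff (monom_mult_coeff a i b j p) p c q k)
      = (\<Oplus>p\<in>(\<lambda>u. i + j - int u) ` {..M}. monom_mult_coeff (monom_mult_coeff a i b j p) p c q k)"
  proof (rule add.finprod_mono_neutral_cong_right[OF fin(1)])
    show "(\<lambda>u. i + j - int u) ` {..M} \<subseteq> P"
      using P M by (auto simp: subset_iff)
  next
    fix p assume p: "p \<in> P - (\<lambda>u. i + j - int u) ` {..M}"
    have "\<not> (p \<le> i + j \<and> k \<le> p + q)"
    proof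
      assume "p \<le> i + j \<and> k \<le> p + q"
      then have "p = i + j - int (nat (i + j - p))" "nat (i + j - p) \<le> M"
        using M by auto
      then show False
        using p by blast
    qed
    then show "monom_mult_coeff (monom_mult_coeff a i b j p) p c q k = \<zero>"
      by (auto simp: monom_mult_coeff_def)
  qed auto
  also have "\<dots> = (\<Oplus>u\<in>{..M}. monom_mult_coeff (monom_mult_coeff a i b j (i + j - int u)) (i + j - int u) c q k)"
    by (rule finsum_reindex) (auto simp: inj_on_def)
  also have "\<dots> = (\<Oplus>u\<in>{..M}. [(int_choose i u * int_choose (i + j - int u) (M - u))] \<cdot> X u)"
  proof (rule finsum_cong')
    fix u assume "u \<in> {..M}"
    then have "k \<le> i + j - int u + q" "nat (i + j - int u + q - k) = M - u"
      using M by auto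
    then show "monom_mult_coeff (monom_mult_coeff a i b j (i + j - int u)) (i + j - int u) c q k
        = [(int_choose i u * int_choose (i + j - int u) (M - u))] \<cdot> X u"
      by (simp add: monom_mult_coeff_def X_def add_pow_ldistr_int add_pow_mult_int mult.commute)
  qed auto
  also have "\<dots> = (\<Oplus>u\<in>{..M}. [(\<Sum>s\<le>M. int_choose i s * int (s choose u) * int_choose j (M - s))] \<cdot> X u)"
    by (intro finsum_cong') (auto simp: int_choose_Vandermonde)
  also have "\<dots> = (\<Oplus>u\<in>{..M}. \<Oplus>s\<in>{..M}. [(int_choose i s * int (s choose u) * int_choose j (M - s))] \<cdot> X u)"
    by (intro finsum_cong') (auto simp: finsum_add_pow_int)
  also have "\<dots> = (\<Oplus>s\<in>{..M}. \<Oplus>u\<in>{..M}. [(int_choose i s * int (s choose u) * int_choose j (M - s))] \<cdot> X u)"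
    by (intro add.finprod_finprod_swap) auto
  also have "\<dots> = (\<Oplus>s\<in>{..M}. monom_mult_coeff a i (monom_mult_coeff b j c q (k - i + int s)) (k - i + int s) k)"
  proof (rule finsum_cong')
    fix s assume "s \<in> {..M}"
    then have s: "s \<le> M" "k - i + int s \<le> j + q" "nat (j + q - (k - i + int s)) = M - s"
      using M by auto
    let ?c = "\<lambda>u. [(int_choose i s * int_choose j (M - s))] \<cdot> ([(int (s choose u))] \<cdot> X u)"
    have "(\<Oplus>u\<in>{..M}. [(int_choose i s * int (s choose u) * int_choose j (M - s))] \<cdot> X u)
        = (\<Oplus>u\<in>{..s}. ?c u)"
      using s by (intro add.finprod_mono_neutral_cong_right)
        (auto simp: binomial_eq_0 add_pow_mult_int mult_ac)
    also have "\<dots> = [(int_choose i s * int_choose j (M - s))] \<cdot> (\<Oplus>u\<in>{..s}. [(int (s choose u))] \<cdot> X u)"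
      by (simp add: add_pow_finsum_int)
    also have "(\<Oplus>u\<in>{..s}. [(int (s choose u))] \<cdot> X u)
        = (\<Oplus>u\<in>{..s}. a \<otimes> [(int (s choose u))] \<cdot> ((d ^^ u) b \<otimes> (d ^^ (s - u)) ((d ^^ (M - s)) c)))"
    proof (rule finsum_cong')
      fix u assume "u \<in> {..s}"
      then have "(d ^^ (s - u)) ((d ^^ (M - s)) c) = (d ^^ (M - u)) c"
        using s by (simp flip: funpow_add comp_apply[of "d ^^ _" "d ^^ _"])
      then show "[(int (s choose u))] \<cdot> X u
          = a \<otimes> [(int (s choose u))] \<cdot> ((d ^^ u) b \<otimes> (d ^^ (s - u)) ((d ^^ (M - s)) c))"
        by (simp add: X_def add_pow_rdistr_int m_assoc)
    qed auto
    also have "\<dots> = a \<otimes> (d ^^ s) (b \<otimes> (d ^^ (M - s)) c)"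
      by (subst higher_leibniz) (auto intro!: finsum_rdistr[symmetric])
    also have "[(int_choose i s * int_choose j (M - s))] \<cdot> \<dots>
        = monom_mult_coeff a i (monom_mult_coeff b j c q (k - i + int s)) (k - i + int s) k"
      using s by (simp add: monom_mult_coeff_def higher_d_add_pow add_pow_rdistr_int add_pow_mult_int)
    finally show "(\<Oplus>u\<in>{..M}. [(int_choose i s * int (s choose u) * int_choose j (M - s))] \<cdot> X u)
        = monom_mult_coeff a i (monom_mult_coeff b j c q (k - i + int s)) (k - i + int s) k" .
  qed auto
  also have "\<dots> = (\<Oplus>p\<in>(\<lambda>s. k - i + int s) ` {..M}. monom_mult_coeff a i (monom_mult_coeff b j c q p) p k)"
    by (rule finsum_reindex[symmetric]) (auto simp: inj_on_def)
  also have "\<dots> = (\<Oplus>p\<in>P'. monom_mult_coeff a i (monom_mult_coeff b j c q p) p k)"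
  proof (rule add.finprod_mono_neutral_cong_left[OF fin(2)])
    show "(\<lambda>s. k - i + int s) ` {..M} \<subseteq> P'"
      using P' M by (auto simp: subset_iff)
  next
    fix p assume p: "p \<in> P' - (\<lambda>s. k - i + int s) ` {..M}"
    have "\<not> (p \<le> j + q \<and> k \<le> i + p)"
    proof
      assume "p \<le> j + q \<and> k \<le> i + p"
      then have "p = k - i + int (nat (p - k + i))" "nat (p - k + i) \<le> M"
        using M by auto
      then show False
        using p by blast
    qed
    then show "monom_mult_coeff a i (monom_mult_coeff b j c q p) p k = \<zero>"
      by (auto simp: monom_mult_coeff_def)
  qed auto
  finally show ?thesis .
qed

text \<open>
  Both bracketings are expanded into the same finite sum over monomials of the three factors; then
  \<open>monom_mult_assoc\<close> applies term by term.
\<close>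

lemma psdo_mult_assoc:
  assumes f: "f \<in> carrier (psdo_ring A d)" and g: "g \<in> carrier (psdo_ring A d)"
    and h: "h \<in> carrier (psdo_ring A d)"
  shows "f \<otimes>\<^bsub>psdo_ring A d\<^esub> g \<otimes>\<^bsub>psdo_ring A d\<^esub> h = f \<otimes>\<^bsub>psdo_ring A d\<^esub> (g \<otimes>\<^bsub>psdo_ring A d\<^esub> h)"
proof
  fix k
  let ?m = "\<lambda>f g. f \<otimes>\<^bsub>psdo_ring A d\<^esub> g"
  obtain N where N: "\<forall>i>N. f i = \<zero>" using f by auto
  obtain M where M: "\<forall>i>M. g i = \<zero>" using g by auto
  obtain Q where Q: "\<forall>i>Q. h i = \<zero>" using h by auto
  have fgh [simp]: "f i \<in> carrier A" "g i \<in> carrier A" "h i \<in> carrier A" for i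
    using f g h by auto
  have fg: "?m f g p \<in> carrier A" "\<forall>p>N + M. ?m f g p = \<zero>" for p
    using psdo_mult_closed[OF f g N M] by auto
  have gh: "?m g h p \<in> carrier A" "\<forall>p>M + Q. ?m g h p = \<zero>" for p
    using psdo_mult_closed[OF g h M Q] by auto
  have fgc: "?m f g \<in> carrier (psdo_ring A d)" and ghc: "?m g h \<in> carrier (psdo_ring A d)"
    using fg gh by auto
  \<comment> \<open>Given upper bounds \<open>N\<close>, \<open>M\<close>, \<open>Q\<close> for the exponents in the factors, these ranges contain all
    exponents of the factors (\<open>I\<close>, \<open>J\<close>, \<open>H\<close>) and of the inner products (\<open>P\<close>, \<open>P'\<close>) that
    can contribute to the coefficient at \<open>k\<close>.\<close>
  define I where "I = {k - Q - M..N}"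
  define J where "J = {k - Q - N..M}"
  define H where "H = {k - (N + M)..Q}"
  define P where "P = {k - Q..N + M}"
  define P' where "P' = {k - N..M + Q}"
  have [simp]: "finite I" "finite J" "finite H" "finite P" "finite P'"
    by (simp_all add: I_def J_def H_def P_def P'_def)
  have "?m (?m f g) h k = (\<Oplus>p\<in>P. \<Oplus>q\<in>H. monom_mult_coeff (?m f g p) p (h q) q k)"
    unfolding P_def H_def using psdo_mult_bounded[OF fgc h fg(2) Q, of k k] by simp
  also have "\<dots> = (\<Oplus>p\<in>P. \<Oplus>q\<in>H. monom_mult_coeff (\<Oplus>i\<in>I. \<Oplus>j\<in>J. monom_mult_coeff (f i) i (g j) j p) p (h q) q k)"
    using fg by (intro finsum_cong')
      (auto simp: P_def I_def J_def psdo_mult_bounded[OF f g N M, of "k - Q"] intro!: finsum_closed)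
  also have "\<dots> = (\<Oplus>p\<in>P. \<Oplus>q\<in>H. \<Oplus>i\<in>I. \<Oplus>j\<in>J. monom_mult_coeff (monom_mult_coeff (f i) i (g j) j p) p (h q) q k)"
    by (simp add: monom_mult_coeff_finsum_left finsum_closed Pi_def cong: finsum_cong)
  also have "\<dots> = (\<Oplus>q\<in>H. \<Oplus>i\<in>I. \<Oplus>j\<in>J. \<Oplus>p\<in>P. monom_mult_coeff (monom_mult_coeff (f i) i (g j) j p) p (h q) q k)"
    by (simp add: add.finprod_finprod_swap[of P] finsum_closed Pi_def cong: finsum_cong)
  also have "\<dots> = (\<Oplus>q\<in>H. \<Oplus>i\<in>I. \<Oplus>j\<in>J. \<Oplus>p\<in>P'. monom_mult_coeff (f i) i (monom_mult_coeff (g j) j (h q) q p) p k)"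
    by (intro finsum_cong' refl monom_mult_assoc Pi_I finsum_closed)
      (auto simp: I_def J_def H_def P_def P'_def)
  also have "\<dots> = (\<Oplus>i\<in>I. \<Oplus>p\<in>P'. \<Oplus>j\<in>J. \<Oplus>q\<in>H. monom_mult_coeff (f i) i (monom_mult_coeff (g j) j (h q) q p) p k)"
    by (simp add: add.finprod_finprod_swap[of H] add.finprod_finprod_swap[of J P'] finsum_closed Pi_def cong: finsum_cong)
  also have "\<dots> = (\<Oplus>i\<in>I. \<Oplus>p\<in>P'. monom_mult_coeff (f i) i (\<Oplus>j\<in>J. \<Oplus>q\<in>H. monom_mult_coeff (g j) j (h q) q p) p k)"
    by (simp add: monom_mult_coeff_finsum_right finsum_closed Pi_def cong: finsum_cong)
  also have "\<dots> = (\<Oplus>i\<in>I. \<Oplus>p\<in>P'. monom_mult_coeff (f i) i (?m g h p) p k)"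
  proof -
    have "?m g h p = (\<Oplus>j\<in>J. \<Oplus>q\<in>H. monom_mult_coeff (g j) j (h q) q p)" if "p \<in> P'" for p
      using that psdo_mult_bounded[OF g h M Q, of "k - N" p]
      by (simp add: P'_def J_def H_def algebra_simps)
    then show ?thesis
      using gh by (intro finsum_cong') (auto intro!: finsum_closed)
  qed
  also have "\<dots> = ?m f (?m g h) k"
    unfolding P'_def I_def using psdo_mult_bounded[OF f ghc N gh(2), of k k]
    by (simp add: algebra_simps)
  finally show "?m (?m f g) h k = ?m f (?m g h) k" .
qed

end

section \<open>The ring of pseudo-differential operators\<close>

lemma (in ring) psdo_ring_abelian_group: "abelian_group (psdo_ring R d)"
proof (rule abelian_groupI)
  fix f g assume "f \<in> carrier (psdo_ring R d)" "g \<in> carrier (psdo_ring R d)"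
  then obtain N M where f: "\<And>i. f i \<in> carrier R" "\<forall>i>N. f i = \<zero>"
    and g: "\<And>i. g i \<in> carrier R" "\<forall>i>M. g i = \<zero>"
    by auto
  have "\<forall>i>max N M. f i \<oplus> g i = \<zero>"
    using f g by auto
  then have "\<exists>N. \<forall>i>N. f i \<oplus> g i = \<zero>"
    by blast
  then show "f \<oplus>\<^bsub>psdo_ring R d\<^esub> g \<in> carrier (psdo_ring R d)"
    using f g by auto
next
  fix f assume f: "f \<in> carrier (psdo_ring R d)"
  then show "\<exists>g\<in>carrier (psdo_ring R d). g \<oplus>\<^bsub>psdo_ring R d\<^esub> f = \<zero>\<^bsub>psdo_ring R d\<^esub>"
    by (intro bexI[of _ "\<lambda>i. \<ominus> f i"]) (auto simp: l_neg fun_eq_iff)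
qed (auto simp: a_ac)

lemma (in derivation) psdo_ring_is_ring: "ring (psdo_ring A d)"
proof (rule ringI)
  show "abelian_group (psdo_ring A d)"
    by (rule psdo_ring_abelian_group)
  show "monoid (psdo_ring A d)"
  proof (rule monoidI)
    fix f g assume fg: "f \<in> carrier (psdo_ring A d)" "g \<in> carrier (psdo_ring A d)"
    then obtain N M where "\<forall>i>N. f i = \<zero>" "\<forall>i>M. g i = \<zero>"
      by auto
    then show "f \<otimes>\<^bsub>psdo_ring A d\<^esub> g \<in> carrier (psdo_ring A d)"
      using psdo_mult_closed[OF fg, of N M] by auto
  next
    show one: "\<one>\<^bsub>psdo_ring A d\<^esub> \<in> carrier (psdo_ring A d)"
      by auto
    fix f assume f: "f \<in> carrier (psdo_ring A d)"
    then obtain N where fc: "\<And>i. f i \<in> carrier A" and N: "\<forall>i>N. f i = \<zero>"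
      by auto
    show "\<one>\<^bsub>psdo_ring A d\<^esub> \<otimes>\<^bsub>psdo_ring A d\<^esub> f = f"
    proof
      fix k
      have "(\<one>\<^bsub>psdo_ring A d\<^esub> \<otimes>\<^bsub>psdo_ring A d\<^esub> f) k
          = (\<Oplus>i\<in>{0}. \<Oplus>j\<in>insert k {k..N}. monom_mult_coeff (\<one>\<^bsub>psdo_ring A d\<^esub> i) i (f j) j k)"
        using N by (intro psdo_mult[OF one f]) (auto split: if_splits simp: not_less[symmetric])
      also have "\<dots> = (\<Oplus>j\<in>insert k {k..N}. monom_mult_coeff \<one> 0 (f j) j k)"
        using fc by (simp add: finsum_closed)
      also have "\<dots> = (\<Oplus>j\<in>insert k {k..N}. if k = j then f j else \<zero>)"
        using fc by (intro finsum_cong') (auto simp: monom_mult_coeff_def int_choose_eq_0)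
      also have "\<dots> = f k"
        using fc by (intro finsum_singleton) auto
      finally show "(\<one>\<^bsub>psdo_ring A d\<^esub> \<otimes>\<^bsub>psdo_ring A d\<^esub> f) k = f k" .
    qed
    show "f \<otimes>\<^bsub>psdo_ring A d\<^esub> \<one>\<^bsub>psdo_ring A d\<^esub> = f"
    proof
      fix k
      have "(f \<otimes>\<^bsub>psdo_ring A d\<^esub> \<one>\<^bsub>psdo_ring A d\<^esub>) k
          = (\<Oplus>i\<in>insert k {k..N}. \<Oplus>j\<in>{0}. monom_mult_coeff (f i) i (\<one>\<^bsub>psdo_ring A d\<^esub> j) j k)"
        using N by (intro psdo_mult[OF f one]) (auto split: if_splits simp: not_less[symmetric])
      also have "\<dots> = (\<Oplus>i\<in>insert k {k..N}. if k = i then f i else \<zero>)"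
        using fc by (intro finsum_cong') (auto simp: monom_mult_coeff_def higher_d_one)
      also have "\<dots> = f k"
        using fc by (intro finsum_singleton) auto
      finally show "(f \<otimes>\<^bsub>psdo_ring A d\<^esub> \<one>\<^bsub>psdo_ring A d\<^esub>) k = f k" .
    qed
  qed (rule psdo_mult_assoc)
next
  fix f g h
  assume f: "f \<in> carrier (psdo_ring A d)" and g: "g \<in> carrier (psdo_ring A d)"
    and h: "h \<in> carrier (psdo_ring A d)"
  then obtain N M Q where bounds: "\<forall>i>N. f i = \<zero>" "\<forall>i>M. g i = \<zero>" "\<forall>i>Q. h i = \<zero>"
    by auto
  define B where "B = max N (max M Q)"
  have B: "\<forall>i>B. f i = \<zero>" "\<forall>i>B. g i = \<zero>" "\<forall>i>B. h i = \<zero>" "\<forall>i>B. (f \<oplus>\<^bsub>psdo_ring A d\<^esub> g) i = \<zero>"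
    using bounds by (auto simp: B_def)
  have fg: "f \<oplus>\<^bsub>psdo_ring A d\<^esub> g \<in> carrier (psdo_ring A d)"
    using psdo_ring_abelian_group f g by (rule abelian_monoid.a_closed[OF abelian_group.axioms(1)])
  have carr [simp]: "f i \<in> carrier A" "g i \<in> carrier A" "h i \<in> carrier A" for i
    using f g h by auto
  note expand = psdo_mult_bounded[OF _ _ _ _ order_refl]
  show "(f \<oplus>\<^bsub>psdo_ring A d\<^esub> g) \<otimes>\<^bsub>psdo_ring A d\<^esub> h
      = f \<otimes>\<^bsub>psdo_ring A d\<^esub> h \<oplus>\<^bsub>psdo_ring A d\<^esub> g \<otimes>\<^bsub>psdo_ring A d\<^esub> h"
    using expand[OF f h B(1,3)] expand[OF g h B(2,3)] expand[OF fg h B(4,3)]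
    by (simp add: fun_eq_iff monom_mult_coeff_add_left finsum_addf finsum_closed Pi_def cong: finsum_cong)
  show "h \<otimes>\<^bsub>psdo_ring A d\<^esub> (f \<oplus>\<^bsub>psdo_ring A d\<^esub> g)
      = h \<otimes>\<^bsub>psdo_ring A d\<^esub> f \<oplus>\<^bsub>psdo_ring A d\<^esub> h \<otimes>\<^bsub>psdo_ring A d\<^esub> g"
    using expand[OF h f B(3,1)] expand[OF h g B(3,2)] expand[OF h fg B(3,4)]
    by (simp add: fun_eq_iff monom_mult_coeff_add_right finsum_addf finsum_closed Pi_def cong: finsum_cong)
qed

text \<open>
  The structure constants of the product are integers and powers of \<open>d\<close>, and \<open>e\<close> commutes with both.
\<close>

lemma (in derivation) coefficientwise_derivation:
  assumes "derivation A e" and comm: "\<And>a. a \<in> carrier A \<Longrightarrow> e (d a) = d (e a)"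
  shows "derivation (psdo_ring A d) (\<lambda>f i. e (f i))"
proof -
  interpret e: derivation A e by fact
  interpret P: ring "psdo_ring A d" by (rule psdo_ring_is_ring)
  have comm_pow: "e ((d ^^ l) a) = (d ^^ l) (e a)" if "a \<in> carrier A" for l a
    using that by (induction l) (auto simp: comm)
  have e_coeff: "e (monom_mult_coeff a i b j k)
      = monom_mult_coeff a i (e b) j k \<oplus> monom_mult_coeff (e a) i b j k"
    if "a \<in> carrier A" "b \<in> carrier A" for a i b j k
    using that by (simp add: monom_mult_coeff_def e.d_add_pow e.d_mult comm_pow add_pow_distrib_int)
  show ?thesis
  proof unfold_locales
    have closed: "(\<lambda>i. e (f i)) \<in> carrier (psdo_ring A d)" if "f \<in> carrier (psdo_ring A d)" for f
    proof -
      from that obtain N where "\<forall>i>N. f i = \<zero>" by auto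
      then have "\<forall>i>N. e (f i) = \<zero>" by simp
      with that show ?thesis by auto
    qed
    fix f g assume f: "f \<in> carrier (psdo_ring A d)" and g: "g \<in> carrier (psdo_ring A d)"
    show "(\<lambda>i. e (f i)) \<in> carrier (psdo_ring A d)"
      by (rule closed) fact
    show "(\<lambda>i. e ((f \<oplus>\<^bsub>psdo_ring A d\<^esub> g) i)) = (\<lambda>i. e (f i)) \<oplus>\<^bsub>psdo_ring A d\<^esub> (\<lambda>i. e (g i))"
      using f g by (simp add: e.d_add)
    show "(\<lambda>i. e ((f \<otimes>\<^bsub>psdo_ring A d\<^esub> g) i))
        = f \<otimes>\<^bsub>psdo_ring A d\<^esub> (\<lambda>i. e (g i)) \<oplus>\<^bsub>psdo_ring A d\<^esub> (\<lambda>i. e (f i)) \<otimes>\<^bsub>psdo_ring A d\<^esub> g"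
    proof
      fix k
      obtain N M where N: "\<forall>i>N. f i = \<zero>" and M: "\<forall>i>M. g i = \<zero>"
        using f g by auto
      have Ne: "\<forall>i>N. e (f i) = \<zero>" and Me: "\<forall>i>M. e (g i) = \<zero>"
        using N M by auto
      have carr [simp]: "f i \<in> carrier A" "g i \<in> carrier A" for i
        using f g by auto
      show "e ((f \<otimes>\<^bsub>psdo_ring A d\<^esub> g) k)
          = (f \<otimes>\<^bsub>psdo_ring A d\<^esub> (\<lambda>i. e (g i)) \<oplus>\<^bsub>psdo_ring A d\<^esub> (\<lambda>i. e (f i)) \<otimes>\<^bsub>psdo_ring A d\<^esub> g) k"
        by (simp add: psdo_mult_bounded[OF f g N M order_refl]
            psdo_mult_bounded[OF f closed[OF g] N Me order_refl]
            psdo_mult_bounded[OF closed[OF f] g Ne M order_refl]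
            e.d_finsum e_coeff finsum_addf finsum_closed Pi_def cong: finsum_cong)
    qed
  qed
qed

text \<open>
  A product of operators of negative order has negative order because orders add up.  A product of
  differential operators is again one because \<open>int_choose i l\<close> vanishes for \<open>0 \<le> i < l\<close>:
  applying \<open>\<partial>\<^sup>i\<close> to a function takes at most \<open>i\<close> derivatives of it.
\<close>

lemma (in derivation) psdo_ring_splitting:
  "ring_splitting (psdo_ring A d) (\<lambda>f i. if 0 \<le> i then f i else \<zero>)"
proof -
  interpret P: ring "psdo_ring A d" by (rule psdo_ring_is_ring)
  show ?thesis
  proof unfold_locales
    let ?p = "\<lambda>f i. if 0 \<le> i then f i else \<zero>"
    have closed: "?p f \<in> carrier (psdo_ring A d)" if "f \<in> carrier (psdo_ring A d)" for f
      using that by auto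
    fix f g assume f: "f \<in> carrier (psdo_ring A d)" and g: "g \<in> carrier (psdo_ring A d)"
    show "?p f \<in> carrier (psdo_ring A d)"
      by (rule closed) fact
    show "?p (f \<oplus>\<^bsub>psdo_ring A d\<^esub> g) = ?p f \<oplus>\<^bsub>psdo_ring A d\<^esub> ?p g"
      by auto
    obtain N M where N: "\<forall>i>N. f i = \<zero>" and M: "\<forall>i>M. g i = \<zero>"
      using f g by auto
    show "?p (?p f \<otimes>\<^bsub>psdo_ring A d\<^esub> ?p g) = ?p f \<otimes>\<^bsub>psdo_ring A d\<^esub> ?p g"
    proof
      fix k
      have "(?p f \<otimes>\<^bsub>psdo_ring A d\<^esub> ?p g) k = \<zero>" if "k < 0"
      proof -
        have "(?p f \<otimes>\<^bsub>psdo_ring A d\<^esub> ?p g) k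
            = (\<Oplus>i\<in>{k - M..N}. \<Oplus>j\<in>{k - N..M}. monom_mult_coeff (?p f i) i (?p g j) j k)"
          using N M by (intro psdo_mult_bounded closed f g) auto
        also have "\<dots> = \<zero>"
          using f g that by (intro add.finprod_one_eqI)
            (auto simp: monom_mult_coeff_def int_choose_eq_0)
        finally show ?thesis .
      qed
      then show "?p (?p f \<otimes>\<^bsub>psdo_ring A d\<^esub> ?p g) k = (?p f \<otimes>\<^bsub>psdo_ring A d\<^esub> ?p g) k"
        by simp
    qed
    have minus: "f \<ominus>\<^bsub>psdo_ring A d\<^esub> ?p f = (\<lambda>i. if i < 0 then f i else \<zero>)"
      if "f \<in> carrier (psdo_ring A d)" for f
    proof -
      have "(\<lambda>i. if i < 0 then f i else \<zero>) \<in> carrier (psdo_ring A d)"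
        using that by auto
      moreover have "f = (\<lambda>i. if i < 0 then f i else \<zero>) \<oplus>\<^bsub>psdo_ring A d\<^esub> ?p f"
        using that by auto
      ultimately show ?thesis
        using closed[OF that] P.add.inv_solve_right[of "\<lambda>i. if i < 0 then f i else \<zero>" f "?p f"] that
        by (simp add: P.minus_eq del: psdo_ring_simps)
    qed
    show "?p ((f \<ominus>\<^bsub>psdo_ring A d\<^esub> ?p f) \<otimes>\<^bsub>psdo_ring A d\<^esub> (g \<ominus>\<^bsub>psdo_ring A d\<^esub> ?p g)) = \<zero>\<^bsub>psdo_ring A d\<^esub>"
    proof
      fix k
      let ?m = "\<lambda>f i. if i < (0::int) then f i else \<zero>"
      have "(?m f \<otimes>\<^bsub>psdo_ring A d\<^esub> ?m g) k = \<zero>" if "0 \<le> k"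
      proof -
        have "(?m f \<otimes>\<^bsub>psdo_ring A d\<^esub> ?m g) k
            = (\<Oplus>i\<in>{}. \<Oplus>j\<in>{}. monom_mult_coeff (?m f i) i (?m g j) j k)"
          using f g that by (intro psdo_mult) (auto split: if_splits)
        then show ?thesis by simp
      qed
      then show "?p ((f \<ominus>\<^bsub>psdo_ring A d\<^esub> ?p f) \<otimes>\<^bsub>psdo_ring A d\<^esub> (g \<ominus>\<^bsub>psdo_ring A d\<^esub> ?p g)) k
          = \<zero>\<^bsub>psdo_ring A d\<^esub> k"
        by (simp add: minus[OF f] minus[OF g])
    qed
  qed
qed

section \<open>Laurent series\<close>

lemma laurent_ring_simps [simp]:
  "carrier (laurent_ring A) = {f. (\<forall>i. f i \<in> carrier A) \<and> (\<exists>N. \<forall>i<N. f i = \<zero>\<^bsub>A\<^esub>)}"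
  "\<one>\<^bsub>laurent_ring A\<^esub> = (\<lambda>i. if i = 0 then \<one>\<^bsub>A\<^esub> else \<zero>\<^bsub>A\<^esub>)"
  "\<zero>\<^bsub>laurent_ring A\<^esub> = (\<lambda>i. \<zero>\<^bsub>A\<^esub>)"
  "f \<oplus>\<^bsub>laurent_ring A\<^esub> g = (\<lambda>i. f i \<oplus>\<^bsub>A\<^esub> g i)"
  by (simp_all add: laurent_ring_def)

lemma (in ring) laurent_mult:
  assumes f: "\<And>i. f i \<in> carrier R" and g: "\<And>i. g i \<in> carrier R" and fin: "finite I"
    and supp: "\<And>i. f i \<noteq> \<zero> \<Longrightarrow> g (k - i) \<noteq> \<zero> \<Longrightarrow> i \<in> I"
  shows "(f \<otimes>\<^bsub>laurent_ring R\<^esub> g) k = (\<Oplus>i\<in>I. f i \<otimes> g (k - i))"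
proof -
  let ?S = "{(i, j). i + j = k \<and> f i \<noteq> \<zero> \<and> g j \<noteq> \<zero>}"
  have "(f \<otimes>\<^bsub>laurent_ring R\<^esub> g) k = finsum R (\<lambda>(i, j). f i \<otimes> g j) ?S"
    by (simp add: laurent_ring_def)
  also have "\<dots> = finsum R (\<lambda>(i, j). f i \<otimes> g j) ((\<lambda>i. (i, k - i)) ` I)"
  proof (rule add.finprod_mono_neutral_cong_left)
    show "?S \<subseteq> (\<lambda>i. (i, k - i)) ` I"
      using supp by (force simp: image_iff)
  next
    fix x assume "x \<in> (\<lambda>i. (i, k - i)) ` I - ?S"
    then show "(case x of (i, j) \<Rightarrow> f i \<otimes> g j) = \<zero>"
      using f g by auto
  qed (use f g fin in auto)
  also have "\<dots> = (\<Oplus>i\<in>I. f i \<otimes> g (k - i))"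
    using f g by (subst finsum_reindex) (auto simp: inj_on_def)
  finally show ?thesis .
qed

lemma (in derivation) psdo_mult_zero_derivation:
  assumes d_null: "\<And>a. a \<in> carrier A \<Longrightarrow> d a = \<zero>"
    and f: "f \<in> carrier (psdo_ring A d)" and g: "g \<in> carrier (psdo_ring A d)"
    and N: "\<forall>i>N. f i = \<zero>" and M: "\<forall>i>M. g i = \<zero>"
  shows "(f \<otimes>\<^bsub>psdo_ring A d\<^esub> g) k = (\<Oplus>i\<in>{k - M..N}. f i \<otimes> g (k - i))"
proof -
  have carr [simp]: "f i \<in> carrier A" "g i \<in> carrier A" for i
    using f g by auto
  have pow: "(d ^^ l) a = (if l = 0 then a else \<zero>)" if "a \<in> carrier A" for l a
    using that by (cases l) (auto simp: d_null)
  have "(f \<otimes>\<^bsub>psdo_ring A d\<^esub> g) k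
      = (\<Oplus>i\<in>{k - M..N}. \<Oplus>j\<in>{k - N..M}. monom_mult_coeff (f i) i (g j) j k)"
    by (rule psdo_mult_bounded[OF f g N M order_refl])
  also have "\<dots> = (\<Oplus>i\<in>{k - M..N}. \<Oplus>j\<in>{k - N..M}. if k - i = j then f i \<otimes> g j else \<zero>)"
    by (intro finsum_cong' Pi_I finsum_closed refl) (auto simp: monom_mult_coeff_def pow)
  also have "\<dots> = (\<Oplus>i\<in>{k - M..N}. f i \<otimes> g (k - i))"
    by (intro finsum_cong' finsum_singleton) auto
  finally show ?thesis .
qed

text \<open>
  For the zero derivation \<open>\<partial>\<close> is central, and \<open>R((\<partial>\<inverse>))\<close> is the ring of Laurent series in
  \<open>x = \<partial>\<inverse>\<close>.  Thus the ring axioms and coefficientwise derivations carry over to Laurent series.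
\<close>

lemma (in ring) laurent_psdo_iso:
  "(\<lambda>f i. f (- i)) \<in> ring_iso (psdo_ring R (\<lambda>_. \<zero>)) (laurent_ring R)"
proof (rule ring_iso_memI)
  have bounded: "(\<exists>N. \<forall>i<N. f (- i) = \<zero>) \<longleftrightarrow> (\<exists>N. \<forall>i>N. f i = \<zero>)" for f :: "int \<Rightarrow> 'a"
  proof
    assume "\<exists>N. \<forall>i<N. f (- i) = \<zero>"
    then obtain N where "\<forall>i<N. f (- i) = \<zero>" ..
    then have "\<forall>i>- N. f (- (- i)) = \<zero>"
      by (metis minus_less_iff)
    then show "\<exists>N. \<forall>i>N. f i = \<zero>"
      by auto
  next
    assume "\<exists>N. \<forall>i>N. f i = \<zero>"
    then obtain N where "\<forall>i>N. f i = \<zero>" ..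
    then have "\<forall>i<(- N). f (- i) = \<zero>"
      by (metis less_minus_iff)
    then show "\<exists>N. \<forall>i<N. f (- i) = \<zero>" ..
  qed
  have bounded': "(\<exists>N. \<forall>i>N. f (- i) = \<zero>) \<longleftrightarrow> (\<exists>N. \<forall>i<N. f i = \<zero>)" for f :: "int \<Rightarrow> 'a"
    using bounded[of "\<lambda>i. f (- i)"] by simp
  show "bij_betw (\<lambda>f i. f (- i)) (carrier (psdo_ring R (\<lambda>_. \<zero>))) (carrier (laurent_ring R))"
    by (rule bij_betwI[of _ _ _ "\<lambda>f i. f (- i)"]) (auto simp: bounded bounded')
  fix f g assume f: "f \<in> carrier (psdo_ring R (\<lambda>_. \<zero>))" and g: "g \<in> carrier (psdo_ring R (\<lambda>_. \<zero>))"
  show "(\<lambda>i. f (- i)) \<in> carrier (laurent_ring R)"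
    using f by (simp add: bounded)
  obtain N M where N: "\<forall>i>N. f i = \<zero>" and M: "\<forall>i>M. g i = \<zero>"
    using f g by auto
  have carr [simp]: "f i \<in> carrier R" "g i \<in> carrier R" for i
    using f g by auto
  show "(\<lambda>i. (f \<otimes>\<^bsub>psdo_ring R (\<lambda>_. \<zero>)\<^esub> g) (- i))
      = (\<lambda>i. f (- i)) \<otimes>\<^bsub>laurent_ring R\<^esub> (\<lambda>i. g (- i))"
  proof
    fix k
    have "((\<lambda>i. f (- i)) \<otimes>\<^bsub>laurent_ring R\<^esub> (\<lambda>i. g (- i))) k
        = (\<Oplus>i\<in>uminus ` {- k - M..N}. f (- i) \<otimes> g (- (k - i)))"
    proof (rule laurent_mult)
      fix i assume "f (- i) \<noteq> \<zero>" "g (- (k - i)) \<noteq> \<zero>"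
      then have "- i \<le> N" "- (k - i) \<le> M"
        using N M by (meson not_le)+
      then show "i \<in> uminus ` {- k - M..N}"
        by (intro image_eqI[of _ _ "- i"]) auto
    qed auto
    also have "\<dots> = (\<Oplus>i\<in>{- k - M..N}. f i \<otimes> g (- k - i))"
      by (subst finsum_reindex) auto
    also have "\<dots> = (f \<otimes>\<^bsub>psdo_ring R (\<lambda>_. \<zero>)\<^esub> g) (- k)"
      using derivation.psdo_mult_zero_derivation[OF zero_derivation refl f g N M] by simp
    finally show "(f \<otimes>\<^bsub>psdo_ring R (\<lambda>_. \<zero>)\<^esub> g) (- k)
        = ((\<lambda>i. f (- i)) \<otimes>\<^bsub>laurent_ring R\<^esub> (\<lambda>i. g (- i))) k" by simp
  qed
qed auto

lemma (in ring) laurent_ring_is_ring: "ring (laurent_ring R)"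
  using ring.ring_iso_imp_img_ring[OF derivation.psdo_ring_is_ring[OF zero_derivation] laurent_psdo_iso]
  by (simp add: laurent_ring_def)

lemma (in ring) laurent_coefficientwise_derivation:
  assumes "derivation R e"
  shows "derivation (laurent_ring R) (\<lambda>f i. e (f i))"
proof -
  interpret e: derivation R e by fact
  show ?thesis
    by (rule derivation_ring_iso[OF laurent_psdo_iso derivation.coefficientwise_derivation[OF zero_derivation assms]
          laurent_ring_is_ring]) auto
qed

text \<open>
  In the coefficient of \<open>f g\<close> at \<open>k + 1\<close> the factor \<open>k + 1\<close> splits as \<open>(k + 1 - i) + i\<close>; the two
  sums are the coefficients at \<open>k\<close> of \<open>f g'\<close> and \<open>f' g\<close>.
\<close>

lemma (in ring) laurent_deriv_derivation:
  "derivation (laurent_ring R) (\<lambda>f i. [(i + 1)] \<cdot> f (i + 1))"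
proof -
  interpret L: ring "laurent_ring R" by (rule laurent_ring_is_ring)
  let ?D = "\<lambda>f i. [(i + 1)] \<cdot> f (i + 1)"
  show ?thesis
  proof unfold_locales
    fix f g assume f: "f \<in> carrier (laurent_ring R)" and g: "g \<in> carrier (laurent_ring R)"
    then obtain N M where N: "\<forall>i<N. f i = \<zero>" and M: "\<forall>i<M. g i = \<zero>"
      by auto
    have carr [simp]: "f i \<in> carrier R" "g i \<in> carrier R" for i
      using f g by auto
    have "\<forall>i<N - 1. ?D f i = \<zero>"
      using N by simp
    then show "?D f \<in> carrier (laurent_ring R)"
      by auto
    show "?D (f \<oplus>\<^bsub>laurent_ring R\<^esub> g) = ?D f \<oplus>\<^bsub>laurent_ring R\<^esub> ?D g"
      by (simp add: add_pow_distrib_int)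
    show "?D (f \<otimes>\<^bsub>laurent_ring R\<^esub> g)
        = f \<otimes>\<^bsub>laurent_ring R\<^esub> ?D g \<oplus>\<^bsub>laurent_ring R\<^esub> ?D f \<otimes>\<^bsub>laurent_ring R\<^esub> g"
    proof
      fix k
      define I where "I = {N..k + 1 - M}"
      define X where "X = (\<lambda>i. f i \<otimes> g (k + 1 - i))"
      have X [simp]: "X i \<in> carrier R" for i
        by (simp add: X_def)
      have inI: "i \<in> I" if "f i \<noteq> \<zero>" "g (k + 1 - i) \<noteq> \<zero>" for i
      proof -
        have "N \<le> i" "M \<le> k + 1 - i"
          using that N M by (meson not_le)+
        then show ?thesis by (simp add: I_def)
      qed
      have [simp]: "finite I" by (simp add: I_def)
      have "?D (f \<otimes>\<^bsub>laurent_ring R\<^esub> g) k = (\<Oplus>i\<in>I. [(k + 1)] \<cdot> X i)"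
        using inI by (subst laurent_mult[of f g I]) (auto simp: add_pow_finsum_int X_def)
      also have "\<dots> = (\<Oplus>i\<in>I. [(k + 1 - i)] \<cdot> X i \<oplus> [i] \<cdot> X i)"
        by (intro finsum_cong') (auto simp flip: add_pow_add_int)
      also have "\<dots> = (\<Oplus>i\<in>I. [(k + 1 - i)] \<cdot> X i) \<oplus> (\<Oplus>i\<in>I. [i] \<cdot> X i)"
        by (intro finsum_addf) auto
      also have "(\<Oplus>i\<in>I. [(k + 1 - i)] \<cdot> X i) = (f \<otimes>\<^bsub>laurent_ring R\<^esub> ?D g) k"
      proof -
        have "i \<in> I" if "f i \<noteq> \<zero>" "?D g (k - i) \<noteq> \<zero>" for i
          using that by (intro inI) (auto simp: algebra_simps)
        then have "(f \<otimes>\<^bsub>laurent_ring R\<^esub> ?D g) k = (\<Oplus>i\<in>I. f i \<otimes> ?D g (k - i))"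
          by (intro laurent_mult) auto
        also have "\<dots> = (\<Oplus>i\<in>I. [(k + 1 - i)] \<cdot> X i)"
          by (intro finsum_cong') (auto simp: X_def add_pow_rdistr_int algebra_simps)
        finally show ?thesis by simp
      qed
      also have "(\<Oplus>i\<in>I. [i] \<cdot> X i) = (?D f \<otimes>\<^bsub>laurent_ring R\<^esub> g) k"
      proof -
        have "i \<in> (\<lambda>i. i - 1) ` I" if "?D f i \<noteq> \<zero>" "g (k - i) \<noteq> \<zero>" for i
          using that by (intro image_eqI[of _ _ "i + 1"] inI) auto
        then have "(?D f \<otimes>\<^bsub>laurent_ring R\<^esub> g) k = (\<Oplus>i\<in>(\<lambda>i. i - 1) ` I. ?D f i \<otimes> g (k - i))"
          by (intro laurent_mult) auto
        also have "\<dots> = (\<Oplus>i\<in>I. [i] \<cdot> X i)"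
          by (subst finsum_reindex) (auto simp: inj_on_def X_def add_pow_ldistr_int algebra_simps
              intro!: finsum_cong')
        finally show ?thesis by simp
      qed
      finally show "?D (f \<otimes>\<^bsub>laurent_ring R\<^esub> g) k
          = (f \<otimes>\<^bsub>laurent_ring R\<^esub> ?D g \<oplus>\<^bsub>laurent_ring R\<^esub> ?D f \<otimes>\<^bsub>laurent_ring R\<^esub> g) k"
        by simp
    qed
  qed
qed

section \<open>Iterated extensions as rings of coefficient functions\<close>

lemma flatten_snoc [simp]: "flatten K h (v @ [i]) = h i v"
  by (simp add: flatten_def)

lemma flatten_Nil [simp]: "flatten K h [] = \<zero>\<^bsub>K\<^esub>"
  by (simp add: flatten_def)

lemma (in ring) image_ring_iso:
  assumes "inj f"
  shows "ring (image_ring f R)" and "f \<in> ring_iso R (image_ring f R)"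
  using assms inj_on_subset[of f UNIV]
  by (auto intro!: inj_imp_image_ring_is_ring inj_imp_image_ring_iso)

text \<open>
  The invariant of the iteration: elements of \<open>R\<close> are functions on exponent lists of length \<open>n\<close>,
  the additive structure is pointwise, and the first \<open>q\<close> partial derivatives act on \<open>R\<close> as
  derivations.  The positions below \<open>q\<close> are those of the variables \<open>x\<^sub>i\<close>; later ones hold the
  exponents of the symbols \<open>\<partial>\<^sub>i\<close>.
\<close>

locale coefficient_ring = K: ring K + R: ring R
  for K :: "('a, 'b) ring_scheme" and q n :: nat and R :: "(int list \<Rightarrow> 'a) ring" +
  assumes apply_closed [simp]: "f \<in> carrier R \<Longrightarrow> f w \<in> carrier K"
    and apply_wrong_length: "f \<in> carrier R \<Longrightarrow> length w \<noteq> n \<Longrightarrow> f w = \<zero>\<^bsub>K\<^esub>"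
    and zero_eq: "\<zero>\<^bsub>R\<^esub> = (\<lambda>w. \<zero>\<^bsub>K\<^esub>)"
    and add_eq: "f \<in> carrier R \<Longrightarrow> g \<in> carrier R \<Longrightarrow> f \<oplus>\<^bsub>R\<^esub> g = (\<lambda>w. f w \<oplus>\<^bsub>K\<^esub> g w)"
    and partial_derivation: "p < q \<Longrightarrow> derivation R (partial_deriv K p)"
begin

lemma add_pow_apply:
  assumes "f \<in> carrier R"
  shows "([(c::int)] \<cdot>\<^bsub>R\<^esub> f) w = [c] \<cdot>\<^bsub>K\<^esub> f w"
proof -
  have "group_hom (add_monoid R) (add_monoid K) (\<lambda>f. f w)"
    by (intro group_hom.intro group_hom_axioms.intro R.a_group K.a_group) (simp add: hom_def add_eq)
  from group_hom.hom_int_pow[OF this, of f c] assms show ?thesis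
    by (simp add: add_pow_def)
qed

lemma partial_deriv_commute:
  assumes f: "f \<in> carrier R"
  shows "partial_deriv K p (partial_deriv K s f) = partial_deriv K s (partial_deriv K p f)"
proof (cases "p = s")
  case False
  then show ?thesis
    using f by (auto simp: partial_deriv_def fun_eq_iff K.add_pow_mult_int list_update_swap mult.commute)
qed simp

text \<open>
  The two sides could only differ at lists \<open>v @ [i]\<close> with \<open>length v = p\<close>, where the left-hand side
  differentiates with respect to the last symbol.  But there both vanish, because elements of
  \<open>R\<close> are zero on lists of the wrong length.
\<close>

lemma partial_deriv_flatten:
  assumes h: "\<And>i. h i \<in> carrier R" and p: "p < n"
  shows "partial_deriv K p (flatten K h) = flatten K (\<lambda>i. partial_deriv K p (h i))"
proof
  fix w
  show "partial_deriv K p (flatten K h) w = flatten K (\<lambda>i. partial_deriv K p (h i)) w"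
  proof (cases w rule: rev_cases)
    case (snoc v i)
    show ?thesis
    proof (cases "p < length v")
      case True
      then show ?thesis
        by (simp add: partial_deriv_def snoc nth_append list_update_append)
    next
      case False
      then have "\<And>j. h j v = \<zero>\<^bsub>K\<^esub>"
        using p h by (intro apply_wrong_length) auto
      with False show ?thesis
        by (auto simp: partial_deriv_def snoc nth_append list_update_append less_Suc_eq)
    qed
  qed (simp add: partial_deriv_def)
qed

lemma partial_deriv_flatten_last:
  assumes h: "\<And>i. h i \<in> carrier R"
  shows "partial_deriv K n (flatten K h) = flatten K (\<lambda>i. [(i + 1)] \<cdot>\<^bsub>R\<^esub> h (i + 1))"
proof
  fix w
  show "partial_deriv K n (flatten K h) w = flatten K (\<lambda>i. [(i + 1)] \<cdot>\<^bsub>R\<^esub> h (i + 1)) w"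
  proof (cases w rule: rev_cases)
    case (snoc v i)
    show ?thesis
    proof (cases "length v = n")
      case True
      then show ?thesis
        by (simp add: partial_deriv_def snoc nth_append list_update_append add_pow_apply h)
    next
      case False
      then have "\<And>j. h j v = \<zero>\<^bsub>K\<^esub>" "\<And>j c. h j (v[n := c]) = \<zero>\<^bsub>K\<^esub>"
        using h by (intro apply_wrong_length; simp)+
      with False show ?thesis
        by (auto simp: partial_deriv_def snoc nth_append list_update_append add_pow_apply h less_Suc_eq)
    qed
  qed (simp add: partial_deriv_def)
qed

text \<open>
  The step common to both kinds of extension: \<open>S\<close> is a ring of formal series over \<open>R\<close> in one new
  symbol, with exponents appended to the lists.
\<close>

lemma coefficient_ring_flatten:
  fixes S :: "(int \<Rightarrow> int list \<Rightarrow> 'a) ring"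
  assumes "ring S" and closed: "\<And>h i. h \<in> carrier S \<Longrightarrow> h i \<in> carrier R"
    and zero: "\<zero>\<^bsub>S\<^esub> = (\<lambda>i. \<zero>\<^bsub>R\<^esub>)"
    and add: "\<And>g h. g \<in> carrier S \<Longrightarrow> h \<in> carrier S \<Longrightarrow> g \<oplus>\<^bsub>S\<^esub> h = (\<lambda>i. g i \<oplus>\<^bsub>R\<^esub> h i)"
    and der: "\<And>p. p < q' \<Longrightarrow> \<exists>D. derivation S D \<and>
      (\<forall>h\<in>carrier S. partial_deriv K p (flatten K h) = flatten K (D h))"
  shows "coefficient_ring K q' (Suc n) (image_ring (flatten K) S)"
proof -
  interpret S: ring S by fact
  let ?T = "image_ring (flatten K) S"
  interpret T: ring ?T
    by (rule S.image_ring_iso) (rule inj_flatten)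
  have iso: "flatten K \<in> ring_iso S ?T"
    by (rule S.image_ring_iso) (rule inj_flatten)
  show ?thesis
  proof (intro coefficient_ring.intro coefficient_ring_axioms.intro K.ring_axioms T.ring_axioms)
    fix f w assume "f \<in> carrier ?T"
    then obtain h where h: "h \<in> carrier S" and f: "f = flatten K h"
      by (auto simp: image_ring_carrier)
    show "f w \<in> carrier K"
      using closed[OF h] by (simp add: f flatten_def)
    show "length w \<noteq> Suc n \<Longrightarrow> f w = \<zero>\<^bsub>K\<^esub>"
      using apply_wrong_length[OF closed[OF h]] by (cases w rule: rev_cases) (auto simp: f)
  next
    show "\<zero>\<^bsub>?T\<^esub> = (\<lambda>w. \<zero>\<^bsub>K\<^esub>)"
      by (auto simp: image_ring_zero zero zero_eq flatten_def)
  next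
    fix f g assume "f \<in> carrier ?T" "g \<in> carrier ?T"
    then obtain h h' where h: "h \<in> carrier S" "h' \<in> carrier S" and fg: "f = flatten K h" "g = flatten K h'"
      by (auto simp: image_ring_carrier)
    have "f \<oplus>\<^bsub>?T\<^esub> g = flatten K (h \<oplus>\<^bsub>S\<^esub> h')"
      by (simp add: fg ring_iso_memE(3)[OF iso h])
    also have "\<dots> = (\<lambda>w. f w \<oplus>\<^bsub>K\<^esub> g w)"
      using h closed by (auto simp: fg add add_eq flatten_def)
    finally show "f \<oplus>\<^bsub>?T\<^esub> g = (\<lambda>w. f w \<oplus>\<^bsub>K\<^esub> g w)" .
  next
    fix p assume "p < q'"
    then obtain D where D: "derivation S D"
      "\<And>h. h \<in> carrier S \<Longrightarrow> partial_deriv K p (flatten K h) = flatten K (D h)"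
      using der by blast
    show "derivation ?T (partial_deriv K p)"
      by (rule derivation_ring_iso[OF iso D(1) T.ring_axioms]) (rule D(2))
  qed
qed

text \<open>
  Adjoining \<open>x\<close> adds a derivation: the old ones act on the coefficients, the new one is \<open>d/dx\<close>.
\<close>

lemma coefficient_ring_laurent:
  assumes "q = n"
  shows "coefficient_ring K (Suc n) (Suc n) (image_ring (flatten K) (laurent_ring R))"
proof (rule coefficient_ring_flatten[OF R.laurent_ring_is_ring])
  fix p assume "p < Suc n"
  then consider "p < n" | "p = n" by linarith
  then show "\<exists>D. derivation (laurent_ring R) D \<and>
      (\<forall>h\<in>carrier (laurent_ring R). partial_deriv K p (flatten K h) = flatten K (D h))"
  proof cases
    case 1
    then show ?thesis
      using R.laurent_coefficientwise_derivation[OF partial_derivation] partial_deriv_flatten assms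
      by (intro exI[of _ "\<lambda>h i. partial_deriv K p (h i)"]) simp
  next
    case 2
    then show ?thesis
      using R.laurent_deriv_derivation partial_deriv_flatten_last
      by (intro exI[of _ "\<lambda>h i. [(i + 1)] \<cdot>\<^bsub>R\<^esub> h (i + 1)"]) simp
  qed
qed auto

text \<open>
  The other derivations act on the coefficients, compatibly with the product because they commute
  with the derivation that defines it.
\<close>

lemma coefficient_ring_psdo:
  assumes "r < q" "q \<le> n"
  shows "coefficient_ring K q (Suc n) (image_ring (flatten K) (psdo_ring R (partial_deriv K r)))"
proof -
  interpret d: derivation R "partial_deriv K r"
    by (rule partial_derivation) fact
  show ?thesis
  proof (rule coefficient_ring_flatten[OF d.psdo_ring_is_ring])
    fix p assume p: "p < q"
    have "derivation (psdo_ring R (partial_deriv K r)) (\<lambda>h i. partial_deriv K p (h i))"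
      by (intro d.coefficientwise_derivation partial_derivation p partial_deriv_commute)
    then show "\<exists>D. derivation (psdo_ring R (partial_deriv K r)) D \<and>
        (\<forall>h\<in>carrier (psdo_ring R (partial_deriv K r)).
          partial_deriv K p (flatten K h) = flatten K (D h))"
      using p assms partial_deriv_flatten
      by (intro exI[of _ "\<lambda>h i. partial_deriv K p (h i)"]) simp
  qed auto
qed

lemma plus_part_ring_splitting:
  assumes "r < q"
  shows "ring_splitting (image_ring (flatten K) (psdo_ring R (partial_deriv K r))) (plus_part K)"
proof -
  interpret d: derivation R "partial_deriv K r"
    by (rule partial_derivation) fact
  note iso = ring.image_ring_iso[OF d.psdo_ring_is_ring inj_flatten, of K]
  show ?thesis
  proof (rule ring_splitting_ring_iso[OF iso(2) d.psdo_ring_splitting iso(1)])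
    fix h assume "h \<in> carrier (psdo_ring R (partial_deriv K r))"
    show "plus_part K (flatten K h) = flatten K (\<lambda>i. if 0 \<le> i then h i else \<zero>\<^bsub>R\<^esub>)"
      by (auto simp: plus_part_def flatten_def zero_eq fun_eq_iff)
  qed
qed

end

lemma (in ring) coefficient_ring_const: "coefficient_ring R 0 0 (image_ring (const_elem R) R)"
proof -
  let ?T = "image_ring (const_elem R) R"
  interpret T: ring ?T
    by (rule image_ring_iso) (rule inj_const_elem)
  have iso: "const_elem R \<in> ring_iso R ?T"
    by (rule image_ring_iso) (rule inj_const_elem)
  show ?thesis
  proof unfold_locales
    fix f g assume "f \<in> carrier ?T" "g \<in> carrier ?T"
    then obtain a b where ab: "a \<in> carrier R" "b \<in> carrier R" and fg: "f = const_elem R a" "g = const_elem R b"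
      by (auto simp: image_ring_carrier)
    have "f \<oplus>\<^bsub>?T\<^esub> g = const_elem R (a \<oplus> b)"
      by (simp add: fg ring_iso_memE(3)[OF iso ab])
    also have "\<dots> = (\<lambda>w. f w \<oplus> g w)"
      by (auto simp: fg const_elem_def)
    finally show "f \<oplus>\<^bsub>?T\<^esub> g = (\<lambda>w. f w \<oplus> g w)" .
  qed (auto simp: image_ring_carrier image_ring_zero const_elem_def)
qed

lemma (in ring) coefficient_ring_iterated_laurent:
  "coefficient_ring R n n (iterated_laurent R n)"
proof (induction n)
  case 0
  then show ?case by (simp add: coefficient_ring_const)
next
  case (Suc n)
  then show ?case
    by (simp add: coefficient_ring.coefficient_ring_laurent)
qed

lemma (in ring) coefficient_ring_iterated_psdo:
  "r \<le> n \<Longrightarrow> coefficient_ring R n (n + r) (iterated_psdo R n r)"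
proof (induction r)
  case 0
  then show ?case by (simp add: coefficient_ring_iterated_laurent)
next
  case (Suc r)
  then show ?case
    using coefficient_ring.coefficient_ring_psdo[of R n "n + r" "iterated_psdo R n r" r] by simp
qed

lemma (in ring) P_ring_splitting:
  assumes "n \<ge> 1"
  shows "ring_splitting (P_ring R n) (plus_part R)"
proof -
  obtain r where n: "n = Suc r"
    using assms by (cases n) auto
  then show ?thesis
    using coefficient_ring.plus_part_ring_splitting[OF coefficient_ring_iterated_psdo[of r n], of r]
    by (simp add: P_ring_def)
qed

theorem proposition5:
  fixes K :: "('a, 'b) ring_scheme" and n :: nat
  assumes "field K"
    and char_0: "\<And>c::nat. c > 0 \<Longrightarrow> [c] \<cdot>\<^bsub>K\<^esub> \<one>\<^bsub>K\<^esub> \<noteq> \<zero>\<^bsub>K\<^esub>"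
    and "n \<ge> 1"
  shows "(\<forall>L \<in> commuting_tuples (P_ring K n) n. \<forall>m :: nat \<Rightarrow> nat.
            V_field K n m L \<in> tangent_space (P_ring K n) n L)
       \<and> (\<forall>m l :: nat \<Rightarrow> nat. V_fields_commute_on K n m l (commuting_tuples (P_ring K n) n))"
proof -
  interpret K: field K by fact
  interpret ring_splitting "P_ring K n" "plus_part K"
    using \<open>n \<ge> 1\<close> by (rule K.P_ring_splitting)
  show ?thesis
    unfolding V_fields_commute_on_def V_field_def V_field_deriv_def
    by (auto intro!: lax_field_tangent restrict_ext lax_fields_commute)
qed

end
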